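(* Let $G$ be a Fuchsian group which is of cofinite volume but not cocompact. Then its Lyapunov expansion exponent satisfies $$\lambda_{exp}(p)=0$$ for almost every $p\in S^1$ with respect to Lebesgue measure.
   Context: A Fuchsian group is a discrete subgroup of $SL_2(\mathbb{R})$; it acts by isometries on the hyperbolic plane, taken in the Poincaré unit disc model, and hence by diffeomorphisms on the boundary circle $S^1$; $|g'(p)|$ denotes the derivative at $p\in S^1$ of the action of $g$ on $S^1$ (with respect to the angular coordinate). Let $B(R)$ be the ball of radius $R$ about the identity in $G$ for the word metric of some fixed finite generating set. The Lyapunov expansion exponent of $G$ at $p$ is $$\lambda_{exp}(p):=\limsup_{R\to\infty}\ \max_{g\in B(R)}\ \frac1R\log|g'(p)|.$$ *)

theory Defs
  imports
    "HOL-Analysis.Analysis"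
    "HOL-Algebra.Generated_Groups"
    "HOL-Algebra.Group_Action"
begin

section \<open>The group $SL_2(\mathbb{R})$ and its action on the closed unit disc\<close>

definition SL2R :: "(real^2^2) monoid" where
  "SL2R = \<lparr>carrier = {A. det A = 1}, mult = (**), one = mat 1\<rparr>"

lemma group_SL2R: "group SL2R"
proof (rule groupI)
  fix A :: "real^2^2"
  assume "A \<in> carrier SL2R"
  then have A: "det A = 1" by (simp add: SL2R_def)
  then have "invertible A" by (simp add: invertible_det_nz)
  then obtain B where eq: "B ** A = mat 1" by (auto simp: invertible_def)
  then have "det B * det A = 1" by (metis det_I det_mul)
  with A eq show "\<exists>B\<in>carrier SL2R. B \<otimes>\<^bsub>SL2R\<^esub> A = \<one>\<^bsub>SL2R\<^esub>"
    by (auto simp: SL2R_def)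
qed (auto simp: SL2R_def det_mul matrix_mul_assoc)

definition su_alpha :: "real^2^2 \<Rightarrow> complex" where
  "su_alpha A = Complex ((A$1$1 + A$2$2) / 2) ((A$1$2 - A$2$1) / 2)"

definition su_beta :: "real^2^2 \<Rightarrow> complex" where
  "su_beta A = Complex ((A$1$1 - A$2$2) / 2) (- (A$1$2 + A$2$1) / 2)"

text \<open>The Cayley transform \<open>z \<mapsto> (z - \<i>) / (z + \<i>)\<close> from the upper half plane to the unit disc
  conjugates the Moebius transformation of a real matrix of determinant 1 to a
  transformation given by a matrix in $SU(1,1)$ with first row
  \<open>su_alpha A\<close>, \<open>su_beta A\<close>; see \<open>disc_act_cayley\<close> below. In this form the action extends to the
  unit circle.\<close>

definition disc_act :: "real^2^2 \<Rightarrow> complex \<Rightarrow> complex" where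
  "disc_act A w = (su_alpha A * w + su_beta A) / (cnj (su_beta A) * w + cnj (su_alpha A))"

lemma su_norm_diff:
  assumes "det A = 1"
  shows "(cmod (su_alpha A))\<^sup>2 - (cmod (su_beta A))\<^sup>2 = 1"
  using assms unfolding cmod_power2
  by (simp add: su_alpha_def su_beta_def det_2 power2_eq_square field_simps)

lemma disc_act_denom_nonzero:
  assumes "det A = 1" "cmod w \<le> 1"
  shows "cnj (su_beta A) * w + cnj (su_alpha A) \<noteq> 0"
proof
  assume "cnj (su_beta A) * w + cnj (su_alpha A) = 0"
  then have "cmod (su_alpha A) = cmod (su_beta A) * cmod w"
    by (metis add_eq_0_iff complex_mod_cnj norm_minus_cancel norm_mult)
  also have "\<dots> \<le> cmod (su_beta A)"
    using assms(2) by (simp add: mult_left_le)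
  finally have "(cmod (su_alpha A))\<^sup>2 \<le> (cmod (su_beta A))\<^sup>2" by (simp add: power_mono)
  with su_norm_diff[OF assms(1)] show False by simp
qed

lemma disc_act_cayley:
  assumes "det A = 1" "Im z > 0"
  defines "z' \<equiv> (of_real (A$1$1) * z + of_real (A$1$2)) / (of_real (A$2$1) * z + of_real (A$2$2))"
  shows "disc_act A ((z - \<i>) / (z + \<i>)) = (z' - \<i>) / (z' + \<i>)"
proof -
  define a b c d where "a = complex_of_real (A$1$1)" and "b = complex_of_real (A$1$2)"
    and "c = complex_of_real (A$2$1)" and "d = complex_of_real (A$2$2)"
  note abcd = a_def b_def c_def d_def
  have zi: "z + \<i> \<noteq> 0" using assms(2) by (auto simp: complex_eq_iff)
  have cd: "c * z + d \<noteq> 0"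
  proof
    assume "c * z + d = 0"
    then have "A$2$1 * Im z = 0" "A$2$1 * Re z + A$2$2 = 0"
      by (auto simp: abcd complex_eq_iff)
    then have "A$2$1 = 0" "A$2$2 = 0" using assms(2) by auto
    with assms(1) show False by (simp add: det_2)
  qed
  have al: "su_alpha A = ((a + d) + (b - c) * \<i>) / 2"
    and be: "su_beta A = ((a - d) - (b + c) * \<i>) / 2"
    and cal: "cnj (su_alpha A) = ((a + d) - (b - c) * \<i>) / 2"
    and cbe: "cnj (su_beta A) = ((a - d) + (b + c) * \<i>) / 2"
    by (auto simp: abcd su_alpha_def su_beta_def complex_eq_iff field_simps)
  have "disc_act A ((z - \<i>) / (z + \<i>)) =
     (su_alpha A * (z - \<i>) + su_beta A * (z + \<i>)) /
     (cnj (su_beta A) * (z - \<i>) + cnj (su_alpha A) * (z + \<i>))"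
  proof -
    have "(su_alpha A * (z - \<i>) + su_beta A * (z + \<i>)) =
            (z + \<i>) * (su_alpha A * ((z - \<i>) / (z + \<i>)) + su_beta A)"
      "(cnj (su_beta A) * (z - \<i>) + cnj (su_alpha A) * (z + \<i>)) =
            (z + \<i>) * (cnj (su_beta A) * ((z - \<i>) / (z + \<i>)) + cnj (su_alpha A))"
      using zi by (simp_all add: field_simps)
    then show ?thesis using zi by (simp add: disc_act_def)
  qed
  also have "su_alpha A * (z - \<i>) + su_beta A * (z + \<i>) = (a * z + b) - \<i> * (c * z + d)"
    unfolding al be by (simp add: complex_eq_iff field_simps)
  also have "cnj (su_beta A) * (z - \<i>) + cnj (su_alpha A) * (z + \<i>) = (a * z + b) + \<i> * (c * z + d)"
    unfolding cal cbe by (simp add: complex_eq_iff field_simps)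
  also have "((a * z + b) - \<i> * (c * z + d)) / ((a * z + b) + \<i> * (c * z + d)) =
      (z' - \<i>) / (z' + \<i>)"
  proof -
    have "(a * z + b) - \<i> * (c * z + d) = (c * z + d) * (z' - \<i>)"
         "(a * z + b) + \<i> * (c * z + d) = (c * z + d) * (z' + \<i>)"
      using cd unfolding z'_def abcd[symmetric] by (simp_all add: field_simps)
    then show ?thesis using cd by simp
  qed
  finally show ?thesis .
qed

definition fuchsian_group :: "(real^2^2) set \<Rightarrow> bool" where
  "fuchsian_group G \<longleftrightarrow> subgroup G SL2R \<and> discrete G"


section \<open>The quotient of the hyperbolic plane\<close>

abbreviation unit_disc :: "complex set" where
  "unit_disc \<equiv> ball 0 1"

definition disc_orbit :: "(real^2^2) set \<Rightarrow> complex \<Rightarrow> complex set" where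
  "disc_orbit G z = orbit (SL2R\<lparr>carrier := G\<rparr>) disc_act z"

definition orbit_space :: "(real^2^2) set \<Rightarrow> complex set topology" where
  "orbit_space G = topology (\<lambda>U. U \<subseteq> disc_orbit G ` unit_disc \<and>
     openin (top_of_set unit_disc) {z \<in> unit_disc. disc_orbit G z \<in> U})"

lemma openin_orbit_space:
  "openin (orbit_space G) U \<longleftrightarrow> U \<subseteq> disc_orbit G ` unit_disc \<and>
     openin (top_of_set unit_disc) {z \<in> unit_disc. disc_orbit G z \<in> U}"
proof -
  let ?P = "\<lambda>U. U \<subseteq> disc_orbit G ` unit_disc \<and>
     openin (top_of_set unit_disc) {z \<in> unit_disc. disc_orbit G z \<in> U}"
  have "istopology ?P"
    unfolding istopology_def
  proof (intro conjI allI impI)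
    fix U V assume "?P U" "?P V"
    then have "openin (top_of_set unit_disc)
        ({z \<in> unit_disc. disc_orbit G z \<in> U} \<inter> {z \<in> unit_disc. disc_orbit G z \<in> V})"
      by (intro openin_Int) auto
    also have "{z \<in> unit_disc. disc_orbit G z \<in> U} \<inter> {z \<in> unit_disc. disc_orbit G z \<in> V} =
        {z \<in> unit_disc. disc_orbit G z \<in> U \<inter> V}" by auto
    finally show "openin (top_of_set unit_disc) {z \<in> unit_disc. disc_orbit G z \<in> U \<inter> V}" .
    show "U \<inter> V \<subseteq> disc_orbit G ` unit_disc" using \<open>?P U\<close> by blast
  next
    fix K assume K: "\<forall>U\<in>K. ?P U"
    then have "openin (top_of_set unit_disc) (\<Union>U\<in>K. {z \<in> unit_disc. disc_orbit G z \<in> U})"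
      by (intro openin_Union) auto
    also have "(\<Union>U\<in>K. {z \<in> unit_disc. disc_orbit G z \<in> U}) =
        {z \<in> unit_disc. disc_orbit G z \<in> \<Union>K}" by auto
    finally show "openin (top_of_set unit_disc) {z \<in> unit_disc. disc_orbit G z \<in> \<Union>K}" .
    show "\<Union>K \<subseteq> disc_orbit G ` unit_disc" using K by blast
  qed
  then show ?thesis by (simp add: orbit_space_def topology_inverse')
qed

lemma topspace_orbit_space: "topspace (orbit_space G) = disc_orbit G ` unit_disc"
proof (rule antisym)
  show "topspace (orbit_space G) \<subseteq> disc_orbit G ` unit_disc"
    using openin_topspace[of "orbit_space G"] by (simp only: openin_orbit_space)
  have "{z \<in> unit_disc. disc_orbit G z \<in> disc_orbit G ` unit_disc} = unit_disc" by auto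
  then have "openin (orbit_space G) (disc_orbit G ` unit_disc)"
    by (simp add: openin_orbit_space)
  then show "disc_orbit G ` unit_disc \<subseteq> topspace (orbit_space G)" by (rule openin_subset)
qed

lemma quotient_map_orbit_space:
  "quotient_map (top_of_set unit_disc) (orbit_space G) (disc_orbit G)"
  by (auto simp: quotient_map_def topspace_orbit_space openin_orbit_space)

definition cocompact :: "(real^2^2) set \<Rightarrow> bool" where
  "cocompact G \<longleftrightarrow> compact_space (orbit_space G)"

text \<open>The area form of the metric \<open>2 |dz| / (1 - |z|\<^sup>2)\<close> of curvature -1.\<close>

definition hyperbolic_area :: "complex measure" where
  "hyperbolic_area =
     density lborel (\<lambda>z. ennreal (4 / (1 - (cmod z)\<^sup>2)\<^sup>2) * indicator unit_disc z)"

text \<open>The area of the quotient is the area of a measurable fundamental domain. Elements acting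
  trivially (such as minus the identity matrix) must be exempted from the disjointness
  requirement.\<close>

definition fundamental_domain :: "(real^2^2) set \<Rightarrow> complex set \<Rightarrow> bool" where
  "fundamental_domain G F \<longleftrightarrow>
     F \<in> sets borel \<and> F \<subseteq> unit_disc \<and>
     (\<Union>g\<in>G. disc_act g ` F) = unit_disc \<and>
     (\<forall>g\<in>G. (\<exists>z\<in>unit_disc. disc_act g z \<noteq> z) \<longrightarrow>
        F \<inter> disc_act g ` F \<in> null_sets hyperbolic_area)"

definition cofinite_volume :: "(real^2^2) set \<Rightarrow> bool" where
  "cofinite_volume G \<longleftrightarrow> (\<exists>F. fundamental_domain G F \<and> emeasure hyperbolic_area F < \<infinity>)"


section \<open>Word metrics\<close>

definition word_length :: "('a, 'b) monoid_scheme \<Rightarrow> 'a set \<Rightarrow> 'a \<Rightarrow> nat" where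
  "word_length M S g = (LEAST n. \<exists>ws. length ws = n \<and> set ws \<subseteq> S \<union> m_inv M ` S \<and>
     g = foldr (mult M) ws (one M))"

definition word_metric :: "('a, 'b) monoid_scheme \<Rightarrow> 'a set \<Rightarrow> 'a \<Rightarrow> 'a \<Rightarrow> nat" where
  "word_metric M S g h = word_length M S (mult M (m_inv M g) h)"

definition word_ball :: "('a, 'b) monoid_scheme \<Rightarrow> 'a set \<Rightarrow> real \<Rightarrow> 'a set" where
  "word_ball M S R = {g \<in> generate M S. real (word_metric M S (one M) g) \<le> R}"


section \<open>The Lyapunov expansion exponent\<close>

text \<open>The derivative of the action on the circle, where the angular coordinates on source and
  target are measured from \<open>p\<close> and from the image of \<open>p\<close>, so that the principal argument is
  smooth where it is used.\<close>

definition circle_deriv :: "real^2^2 \<Rightarrow> complex \<Rightarrow> real" where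
  "circle_deriv g p = deriv (\<lambda>t. Arg (disc_act g (p * cis t) / disc_act g p)) 0"

definition lyapunov_exp :: "(real^2^2) set \<Rightarrow> complex \<Rightarrow> ereal" where
  "lyapunov_exp S p =
     Limsup at_top (\<lambda>R::real.
       ereal (Max ((\<lambda>g. 1 / R * ln \<bar>circle_deriv g p\<bar>) ` word_ball SL2R S R)))"

definition circle_lebesgue :: "complex measure" where
  "circle_lebesgue =
     distr (lebesgue_on {0..<2 * pi}) (restrict_space borel (sphere 0 1)) cis"

lemma measurable_cis_circle:
  "cis \<in> lebesgue_on {0..<2 * pi} \<rightarrow>\<^sub>M restrict_space borel (sphere 0 1)"
  by (intro measurable_restrict_space2 measurable_restrict_space1 measurable_completion)
     (auto intro!: borel_measurable_continuous_onI continuous_intros)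

end

theory Submission
  imports Defs
begin

text \<open>Write \<open>o\<close> for the centre of the disc and \<open>d\<close> for the hyperbolic distance. For \<open>z\<close> on the ray
  from \<open>o\<close> to \<open>p\<close>, let \<open>f z = exp (d z (G o))\<close>. If \<open>|g' p| \<ge> exp T\<close>, then \<open>inv g o\<close> lies beyond the point at
  distance about \<open>T\<close> of this ray. A word for \<open>g\<close> of length \<open>n\<close> gives a path in \<open>G o\<close> from \<open>o\<close> to \<open>inv g o\<close> with \<open>n\<close>
  bounded steps, and a step at distance \<open>r\<close> from the ray projects to a piece of the ray of length
  about \<open>exp (- r)\<close>. Hence the integral of \<open>f\<close> along the first \<open>T\<close> units of the ray is \<open>O(n)\<close>, and it
  suffices that the mean of \<open>f\<close> along almost every ray is infinite.

  Since \<open>G\<close> is not cocompact, for every \<open>r\<close> there is a point at distance \<open>r\<close> from \<open>G o\<close>. If the mean of \<open>f\<close>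
  were at most \<open>A\<close>, then the ray would be within \<open>O(log A)\<close> of \<open>G o\<close> more than half of the time; from
  there it reaches, for each \<open>r\<close>, a translate of that point with probability about \<open>exp (- r)\<close>, where
  \<open>f\<close> is about \<open>exp r\<close>. So each \<open>r\<close> contributes a definite amount to the mean, a contradiction. Replacing rays
  by dyadic arcs, this bounds the conditional expectations of a bounded truncation of \<open>f\<close> from below, and
  exponential moments together with the Borel-Cantelli lemma give the almost sure statement.\<close>

section \<open>Sums along random branches of the dyadic tree\<close>

text \<open>The dyadic intervals \<open>[i / 2\<^sup>k, (i + 1) / 2\<^sup>k)\<close> are the nodes \<open>(k, i)\<close> of a binary tree. These are
  the expectation and the Laplace transform of the sum of \<open>f\<close> over the first \<open>n\<close> nodes of a random
  branch starting at \<open>(k, i)\<close>.\<close>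

primrec tree_mean :: "nat \<Rightarrow> (nat \<Rightarrow> int \<Rightarrow> real) \<Rightarrow> nat \<Rightarrow> int \<Rightarrow> real" where
  "tree_mean 0 f k i = 0"
| "tree_mean (Suc n) f k i =
     f k i + (tree_mean n f (Suc k) (2 * i) + tree_mean n f (Suc k) (2 * i + 1)) / 2"

primrec tree_laplace :: "nat \<Rightarrow> real \<Rightarrow> (nat \<Rightarrow> int \<Rightarrow> real) \<Rightarrow> nat \<Rightarrow> int \<Rightarrow> real" where
  "tree_laplace 0 c f k i = 1"
| "tree_laplace (Suc n) c f k i = exp (- c * f k i) *
     ((tree_laplace n c f (Suc k) (2 * i) + tree_laplace n c f (Suc k) (2 * i + 1)) / 2)"

definition branch_sum :: "nat \<Rightarrow> (nat \<Rightarrow> int \<Rightarrow> real) \<Rightarrow> nat \<Rightarrow> real \<Rightarrow> real" where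
  "branch_sum n f k t = (\<Sum>j<n. f (k + j) \<lfloor>2 ^ (k + j) * t\<rfloor>)"

definition tree_cell :: "nat \<Rightarrow> int \<Rightarrow> real set" where
  "tree_cell k i = {t. \<lfloor>2 ^ k * t\<rfloor> = i}"

abbreviation descendants :: "nat \<Rightarrow> int \<Rightarrow> int set" where
  "descendants j i \<equiv> {i * 2 ^ j ..< (i + 1) * 2 ^ j}"

text \<open>Inductions use the recursion over children, while double counting needs averages over
  whole levels; this converts one into the other.\<close>

lemma tree_mean_sum:
  "tree_mean n f k i = (\<Sum>j<n. (\<Sum>l\<in>descendants j i. f (k + j) l) / 2 ^ j)"
proof (induction n arbitrary: k i)
  case (Suc n)
  have split: "(\<Sum>l\<in>descendants (Suc j) i. g l) =
     (\<Sum>l\<in>descendants j (2 * i). g l) + (\<Sum>l\<in>descendants j (2 * i + 1). g l)" for j and g :: "int \<Rightarrow> real"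
  proof -
    have "descendants (Suc j) i = descendants j (2 * i) \<union> descendants j (2 * i + 1)"
      by (auto simp: algebra_simps)
    then show ?thesis by (auto intro!: sum.union_disjoint)
  qed
  have "(\<Sum>j<Suc n. (\<Sum>l\<in>descendants j i. f (k + j) l) / 2 ^ j) =
    f k i + (\<Sum>j<n. (\<Sum>l\<in>descendants (Suc j) i. f (k + Suc j) l) / 2 ^ Suc j)"
  proof -
    have "descendants 0 i = {i}" by auto
    then show ?thesis unfolding sum.lessThan_Suc_shift by simp
  qed
  also have "\<dots> = tree_mean (Suc n) f k i"
    unfolding split by (simp add: Suc.IH sum.distrib add_divide_distrib sum_divide_distrib mult.commute)
  finally show ?case by simp
qed simp

lemma tree_mean_bounds:
  assumes "\<And>k i. 0 \<le> f k i" "\<And>k i. f k i \<le> M"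
  shows "0 \<le> tree_mean n f k i \<and> tree_mean n f k i \<le> n * M"
proof (induction n arbitrary: k i)
  case (Suc n)
  have "real (Suc n) * M = real n * M + M" by (simp add: algebra_simps)
  then show ?case using Suc.IH[of "Suc k" "2 * i"] Suc.IH[of "Suc k" "2 * i + 1"] assms[of k i]
    unfolding tree_mean.simps by argo
qed simp

section \<open>Second-order bounds for the Laplace transform\<close>

lemma exp_neg_le_quadratic:
  fixes x :: real assumes "0 \<le> x" shows "exp (- x) \<le> 1 - x + x\<^sup>2 / 2"
proof -
  have "(\<lambda>x. 1 - x + x\<^sup>2 / 2 - exp (- x)) 0 \<le> (\<lambda>x. 1 - x + x\<^sup>2 / 2 - exp (- x)) x"
  proof (rule DERIV_nonneg_imp_nondecreasing[OF assms])
    fix y :: real assume "0 \<le> y"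
    have "1 + (- y) \<le> exp (- y)" by (rule exp_ge_add_one_self)
    moreover have "((\<lambda>x. 1 - x + x\<^sup>2 / 2 - exp (- x)) has_real_derivative (- 1 + y + exp (- y))) (at y)"
      by (auto intro!: derivative_eq_intros)
    ultimately show "\<exists>z. ((\<lambda>x. 1 - x + x\<^sup>2 / 2 - exp (- x)) has_real_derivative z) (at y) \<and> 0 \<le> z"
      by (intro exI[of _ "- 1 + y + exp (- y)"]) auto
  qed
  then show ?thesis by simp
qed

lemma tree_laplace_nonneg: "0 \<le> tree_laplace n c f k i"
  by (induction n arbitrary: k i) auto

text \<open>The branch sum lies in \<open>[0, n * M]\<close>, so expanding its exponential to second
  order leaves an error of at most \<open>(c * n * M)\<^sup>2\<close>. The induction splits off the
  factor of the root.\<close>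

lemma tree_laplace_le:
  assumes f: "\<And>k i. 0 \<le> f k i" "\<And>k i. f k i \<le> M" and c: "0 \<le> c"
  shows "tree_laplace n c f k i \<le> 1 - c * tree_mean n f k i + (c * n * M)\<^sup>2"
proof (induction n arbitrary: k i)
  case (Suc n)
  define X where "X = (tree_mean n f (Suc k) (2 * i) + tree_mean n f (Suc k) (2 * i + 1)) / 2"
  have X: "0 \<le> X" "X \<le> n * M"
    using tree_mean_bounds[of f M n "Suc k" "2 * i", OF f] tree_mean_bounds[of f M n "Suc k" "2 * i + 1", OF f]
    by (auto simp: X_def)
  define x where "x = f k i"
  have x: "0 \<le> x" "x \<le> M" using f by (auto simp: x_def)
  define e where "e = exp (- c * x)"
  have e: "e \<le> 1" "e \<le> 1 - c * x + (c * x)\<^sup>2 / 2" "1 - c * x \<le> e" "0 \<le> e"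
    using exp_neg_le_quadratic[of "c * x"] exp_ge_add_one_self[of "- c * x"] c x by (auto simp: e_def)
  have "tree_laplace (Suc n) c f k i \<le> e * (1 - c * X + (c * n * M)\<^sup>2)"
  proof -
    have "(tree_laplace n c f (Suc k) (2 * i) + tree_laplace n c f (Suc k) (2 * i + 1)) / 2
        \<le> 1 - c * X + (c * n * M)\<^sup>2"
      using Suc.IH[of "Suc k" "2 * i"] Suc.IH[of "Suc k" "2 * i + 1"]
      unfolding X_def by argo
    then show ?thesis
      using e(4) unfolding tree_laplace.simps e_def x_def by (rule mult_left_mono)
  qed
  also have "\<dots> = e + (c * X) * (- e) + e * (c * n * M)\<^sup>2" by (simp add: algebra_simps)
  \<comment> \<open>Each summand uses its own bound for \<open>e\<close>: the quadratic one, the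
    lower bound \<open>1 - c * x\<close> where \<open>e\<close> occurs with a minus sign, and 1 in
    the error term.\<close>
  also have "\<dots> \<le> (1 - c * x + (c * x)\<^sup>2 / 2) + (c * X) * (- (1 - c * x)) + 1 * (c * n * M)\<^sup>2"
    using e X c by (intro add_mono mult_left_mono mult_right_mono) auto
  also have "\<dots> = 1 - c * (x + X) + c\<^sup>2 * (x * x / 2 + x * X + (n * M)\<^sup>2)"
    by (simp add: algebra_simps power2_eq_square)
  also have "\<dots> \<le> 1 - c * (x + X) + c\<^sup>2 * (M * M + M * (n * M) + (n * M)\<^sup>2)"
  proof -
    have "x * x / 2 \<le> M * M" using mult_mono[OF x(2) x(2)] x zero_le_square[of x] by linarith
    moreover have "x * X \<le> M * (n * M)" using x X by (intro mult_mono) auto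
    ultimately show ?thesis by (intro add_left_mono mult_left_mono) auto
  qed
  also have "\<dots> \<le> 1 - c * (x + X) + (c * Suc n * M)\<^sup>2"
  proof -
    have "(M * M + M * (n * M) + (n * M)\<^sup>2) \<le> (Suc n * M)\<^sup>2"
      using x by (simp add: power2_eq_square algebra_simps)
    then have "c\<^sup>2 * (M * M + M * (n * M) + (n * M)\<^sup>2) \<le> c\<^sup>2 * (Suc n * M)\<^sup>2"
      by (intro mult_left_mono) auto
    then show ?thesis by (simp add: power_mult_distrib)
  qed
  finally show ?case by (simp add: x_def X_def)
qed simp

text \<open>The bound \<open>d\<close> is uniform over all nodes, so it applies to every subtree
  hanging \<open>n\<close> levels below the root and pulls out as a factor.\<close>

lemma tree_laplace_add_le:
  assumes "\<And>k i. tree_laplace m c f k i \<le> d"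
  shows "tree_laplace (n + m) c f k i \<le> tree_laplace n c f k i * d"
proof (induction n arbitrary: k i)
  case (Suc n)
  have "(tree_laplace (n + m) c f (Suc k) (2 * i) + tree_laplace (n + m) c f (Suc k) (2 * i + 1)) / 2
      \<le> (tree_laplace n c f (Suc k) (2 * i) + tree_laplace n c f (Suc k) (2 * i + 1)) / 2 * d"
    using Suc.IH[of "Suc k" "2 * i"] Suc.IH[of "Suc k" "2 * i + 1"] by argo
  from mult_left_mono[OF this, of "exp (- c * f k i)"] show ?case by (simp add: mult.assoc)
qed (use assms in simp)

lemma tree_laplace_power_le:
  assumes "\<And>k i. tree_laplace m c f k i \<le> d" "0 \<le> d"
  shows "tree_laplace (b * m) c f k i \<le> d ^ b"
proof (induction b)
  case (Suc b)
  have "tree_laplace (b * m + m) c f k i \<le> tree_laplace (b * m) c f k i * d"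
    by (rule tree_laplace_add_le[OF assms(1)])
  also have "\<dots> \<le> d ^ b * d" using Suc assms by (intro mult_right_mono) auto
  finally show ?case by (simp add: algebra_simps)
qed simp

section \<open>Exponential Markov inequality on dyadic cells\<close>

lemma branch_sum_Suc:
  "branch_sum (Suc n) f k t = f k \<lfloor>2 ^ k * t\<rfloor> + branch_sum n f (Suc k) t"
  unfolding branch_sum_def sum.lessThan_Suc_shift by simp

lemma branch_sum_measurable [measurable]: "branch_sum n f k \<in> borel_measurable borel"
proof -
  have [measurable]: "(\<lambda>t::real. f j \<lfloor>2 ^ j * t\<rfloor>) \<in> borel_measurable borel" for j
    by (rule measurable_compose[where g = "f j" and N = "count_space UNIV"]) measurable
  show ?thesis unfolding branch_sum_def by measurable
qed

lemma tree_cell_eq: "tree_cell k i = {i / 2 ^ k ..< (i + 1) / 2 ^ k}"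
  by (auto simp: tree_cell_def floor_eq_iff field_simps)

lemma tree_cell_children: "tree_cell k i = tree_cell (Suc k) (2 * i) \<union> tree_cell (Suc k) (2 * i + 1)"
proof -
  have "\<lfloor>2 ^ k * t\<rfloor> = \<lfloor>2 ^ Suc k * t\<rfloor> div 2" for t :: real
    using floor_divide_real_eq_div[of 2 "2 ^ Suc k * t"] by simp
  then show ?thesis unfolding tree_cell_def by auto
qed

text \<open>Chernoff's bound for Lebesgue measure on one cell. In the induction the root value is
  subtracted from the threshold and the two halves of the cell are treated separately.\<close>

lemma emeasure_branch_sum_le:
  assumes "0 \<le> c"
  shows "emeasure lborel {t \<in> tree_cell k i. branch_sum n f k t \<le> s}
    \<le> ennreal (exp (c * s) * tree_laplace n c f k i / 2 ^ k)"
proof (induction n arbitrary: k i s)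
  case 0
  show ?case
  proof (cases "0 \<le> s")
    case True
    then have "1 \<le> exp (c * s)" using assms by simp
    have "{t \<in> tree_cell k i. branch_sum 0 f k t \<le> s} = {i / 2 ^ k ..< (i + 1) / 2 ^ k}"
      using True by (auto simp: branch_sum_def tree_cell_eq)
    then have "emeasure lborel {t \<in> tree_cell k i. branch_sum 0 f k t \<le> s} = ennreal (1 / 2 ^ k)"
      by (simp add: field_simps)
    then show ?thesis using \<open>1 \<le> exp (c * s)\<close> by (simp add: divide_right_mono ennreal_leI)
  qed (simp add: branch_sum_def)
next
  case (Suc n)
  let ?A = "\<lambda>l. {t \<in> tree_cell (Suc k) l. branch_sum n f (Suc k) t \<le> s - f k i}"
  have meas: "?A l \<in> sets lborel" for l
    unfolding tree_cell_eq by measurable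
  have "{t \<in> tree_cell k i. branch_sum (Suc n) f k t \<le> s} = ?A (2 * i) \<union> ?A (2 * i + 1)"
    unfolding tree_cell_children[of k i] using tree_cell_children[of k i]
    by (auto simp: branch_sum_Suc tree_cell_def set_eq_iff algebra_simps)
  then have "emeasure lborel {t \<in> tree_cell k i. branch_sum (Suc n) f k t \<le> s} \<le>
     emeasure lborel (?A (2 * i)) + emeasure lborel (?A (2 * i + 1))"
    using emeasure_subadditive[OF meas meas] by simp
  also have "\<dots> \<le> ennreal (exp (c * (s - f k i)) * tree_laplace n c f (Suc k) (2 * i) / 2 ^ Suc k) +
     ennreal (exp (c * (s - f k i)) * tree_laplace n c f (Suc k) (2 * i + 1) / 2 ^ Suc k)"
    by (intro add_mono Suc.IH)
  also have "\<dots> = ennreal (exp (c * s) * tree_laplace (Suc n) c f k i / 2 ^ k)"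
    by (subst ennreal_plus[symmetric])
       (auto simp: tree_laplace_nonneg right_diff_distrib exp_diff exp_minus field_simps)
  finally show ?case .
qed

text \<open>A node with a small value that has not just left a region of large values
  reaches values of every size \<open>2\<^sup>r\<close> at a neighbouring node \<open>r\<close> levels below.\<close>

definition spreading :: "(nat \<Rightarrow> int \<Rightarrow> real) \<Rightarrow> bool" where
  "spreading F \<longleftrightarrow> (\<forall>B. \<exists>D K. \<forall>k i. D \<le> k \<longrightarrow> F k i \<le> B \<longrightarrow> F (k - D) (i div 2 ^ D) \<le> B \<longrightarrow>
     (\<forall>r. \<exists>l. \<bar>l - i * 2 ^ r\<bar> \<le> int K * 2 ^ r \<and> 2 ^ r \<le> real K * F (k + r) l \<and>
        F (k + r) l \<le> real K * 2 ^ r))"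

section \<open>Counting nodes with values of prescribed size\<close>

lemma sum_fibre_card_le:
  fixes h :: "'b \<Rightarrow> real"
  assumes "finite A" "finite B" "g ` A \<subseteq> B" "\<And>b. b \<in> B \<Longrightarrow> 0 \<le> h b"
    and card: "\<And>b. b \<in> B \<Longrightarrow> card {a \<in> A. g a = b} \<le> m"
  shows "(\<Sum>a\<in>A. h (g a)) \<le> m * (\<Sum>b\<in>B. h b)"
proof -
  have "(\<Sum>a\<in>A. h (g a)) = (\<Sum>b\<in>B. \<Sum>a\<in>{a \<in> A. g a = b}. h (g a))"
    by (rule sum.group[symmetric]) (use assms in auto)
  also have "\<dots> = (\<Sum>b\<in>B. card {a \<in> A. g a = b} * h b)"
    by (intro sum.cong) auto
  also have "\<dots> \<le> (\<Sum>b\<in>B. m * h b)"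
    using card assms(4) by (intro sum_mono mult_right_mono) auto
  finally show ?thesis by (simp add: sum_distrib_left)
qed

text \<open>A node has at most \<open>2 ^ D\<close> descendants \<open>D\<close> levels below it,
  seen by the injection into quotient and remainder. Hence nodes with a bad ancestor have at most
  the density of the bad ancestors.\<close>

lemma card_descendants_div_le:
  "card {l \<in> descendants (j + D) i. P (l div 2 ^ D)} \<le> 2 ^ D * card {l \<in> descendants j i. P l}"
proof -
  have "inj_on (\<lambda>l. (l div 2 ^ D, l mod 2 ^ D)) {l \<in> descendants (j + D) i. P (l div 2 ^ D)}"
  proof (rule inj_onI)
    fix x y :: int assume "(x div 2 ^ D, x mod 2 ^ D) = (y div 2 ^ D, y mod 2 ^ D)"
    then show "x = y" by (metis div_mult_mod_eq prod.inject)
  qed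
  moreover have "(\<lambda>l. (l div 2 ^ D, l mod 2 ^ D)) ` {l \<in> descendants (j + D) i. P (l div 2 ^ D)}
     \<subseteq> {l \<in> descendants j i. P l} \<times> {0..<2 ^ D}"
  proof -
    have "i * 2 ^ j \<le> l div 2 ^ D" if "i * 2 ^ (j + D) \<le> l" for l :: int
    proof -
      have *: "i * 2 ^ (j + D) = i * 2 ^ j * 2 ^ D" by (simp add: power_add)
      show ?thesis using zdiv_mono1[OF that, of "2 ^ D"] unfolding * by simp
    qed
    moreover have "l div 2 ^ D < (i + 1) * 2 ^ j" if "l < (i + 1) * 2 ^ (j + D)" for l :: int
    proof (rule ccontr)
      assume "\<not> ?thesis"
      then have "(i + 1) * 2 ^ j * 2 ^ D \<le> l div 2 ^ D * 2 ^ D"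
        by (intro mult_right_mono) auto
      moreover have "l div 2 ^ D * 2 ^ D \<le> l"
        by (simp flip: minus_mod_eq_div_mult)
      ultimately have "(i + 1) * 2 ^ j * 2 ^ D \<le> l" by (rule order_trans)
      moreover have "(i + 1) * 2 ^ (j + D) = (i + 1) * 2 ^ j * 2 ^ D" by (simp add: power_add)
      ultimately show False using that by linarith
    qed
    ultimately show ?thesis by auto
  qed
  moreover have "finite ({l \<in> descendants j i. P l} \<times> {0..<2 ^ D :: int})"
    by (intro finite_cartesian_product finite_subset[OF Collect_restrict] finite_atLeastLessThan_int)
  ultimately have "card {l \<in> descendants (j + D) i. P (l div 2 ^ D)}
     \<le> card ({l \<in> descendants j i. P l} \<times> {0..<2 ^ D :: int})"
    by (rule card_inj_on_le)
  also have "\<dots> = card {l \<in> descendants j i. P l} * 2 ^ D"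
    unfolding card_cartesian_product by (simp add: nat_power_eq)
  finally show ?thesis by (simp only: mult.commute)
qed

text \<open>Any two such powers of 2 differ by a factor of at most \<open>K\<^sup>2\<close>, and
  \<open>n < 2 ^ n\<close> turns this into a crude bound for the spread of the exponents. It limits
  how many scales can be charged to one value.\<close>

lemma dyadic_window:
  assumes "0 < K"
  obtains r0 :: nat where "{r. 2 ^ r \<le> real K * x \<and> x \<le> real K * 2 ^ r} \<subseteq> {r0..<r0 + K\<^sup>2}"
proof (cases "{r. 2 ^ r \<le> real K * x \<and> x \<le> real K * 2 ^ r} = {}")
  case True
  then show ?thesis using that by auto
next
  case False
  let ?P = "\<lambda>r. 2 ^ r \<le> real K * x \<and> x \<le> real K * 2 ^ r"
  define r0 where "r0 = (LEAST r. ?P r)"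
  obtain r1 where r1: "?P r1" using False by blast
  have r0: "?P r0" unfolding r0_def by (rule LeastI[of ?P, OF r1])
  have "r \<in> {r0..<r0 + K\<^sup>2}" if "?P r" for r
  proof -
    have "r0 \<le> r" using that unfolding r0_def by (rule Least_le)
    have "(2::real) ^ r \<le> real K * (real K * 2 ^ r0)"
      using that r0 mult_left_mono[of x "real K * 2 ^ r0" "real K"] by linarith
    then have "2 ^ r0 * 2 ^ (r - r0) \<le> real (K\<^sup>2) * 2 ^ r0"
      using \<open>r0 \<le> r\<close> by (simp add: power2_eq_square mult.assoc power_add[symmetric])
    then have "(2::real) ^ (r - r0) \<le> real (K\<^sup>2)"
      using mult_le_cancel_right[of "2 ^ (r - r0)" "2 ^ r0" "real (K\<^sup>2)"] by (simp add: mult.commute)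
    then have "2 ^ (r - r0) \<le> K\<^sup>2" using of_nat_le_iff[of "2 ^ (r - r0)" "K\<^sup>2", where 'a = real] by simp
    then have "r - r0 < K\<^sup>2" using less_exp[of "r - r0"] by linarith
    then show ?thesis using \<open>r0 \<le> r\<close> by auto
  qed
  then have "{r. ?P r} \<subseteq> {r0..<r0 + K\<^sup>2}" by (intro subsetI) (simp only: mem_Collect_eq)
  then show ?thesis by (rule that)
qed

lemma card_ge_of_cover:
  assumes "finite A" "A \<subseteq> G \<union> X \<union> Y \<union> Z" "finite G" "finite X" "finite Y" "finite Z"
  shows "real (card A) - card X - card Y - card Z \<le> card G"
proof -
  have "card A \<le> card (G \<union> X \<union> Y \<union> Z)" using assms by (intro card_mono) auto
  also have "\<dots> \<le> card G + card X + card Y + card Z"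
    by (meson add_le_mono1 card_Un_le le_trans)
  finally show ?thesis by linarith
qed


text \<open>By contradiction: a mean below \<open>A * T\<close> makes most nodes good, so that
  spreading applies to them. For each \<open>r < N\<close> a good node finds a node \<open>r\<close>
  levels below with value about \<open>2 ^ r\<close>, which offsets the weight lost on the way down.
  As no node is found more than \<open>m\<close> times, the \<open>N\<close> scales together push
  the mean above \<open>A * T\<close>.\<close>

lemma tree_mean_ge:
  fixes A :: real
  assumes nonneg: "\<And>k i. 0 \<le> F k i" and spread: "spreading F" and A: "0 < A"
  obtains N T :: nat where "0 < T" "\<And>k i. A * T \<le> tree_mean T (\<lambda>k i. min (F k i) (2 ^ N)) k i"
proof -
  define B where "B = 8 * A" \<comment> \<open>by Markov's inequality, values above \<open>B\<close> have weight less than 1/8\<close>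
  obtain D K0 where DK0: "\<And>k i r. D \<le> k \<Longrightarrow> F k i \<le> B \<Longrightarrow> F (k - D) (i div 2 ^ D) \<le> B \<Longrightarrow>
     (\<exists>l. \<bar>l - i * 2 ^ r\<bar> \<le> int K0 * 2 ^ r \<and> 2 ^ r \<le> real K0 * F (k + r) l \<and> F (k + r) l \<le> real K0 * 2 ^ r)"
    using spread unfolding spreading_def by meson
  define K where "K = Suc K0"
  have DK: "\<exists>l. \<bar>l - i * 2 ^ r\<bar> \<le> int K * 2 ^ r \<and> 2 ^ r \<le> real K * F (k + r) l \<and> F (k + r) l \<le> real K * 2 ^ r"
    if hyp: "D \<le> k" "F k i \<le> B" "F (k - D) (i div 2 ^ D) \<le> B" for k i r
  proof -
    obtain l where l: "\<bar>l - i * 2 ^ r\<bar> \<le> int K0 * 2 ^ r" "2 ^ r \<le> real K0 * F (k + r) l" "F (k + r) l \<le> real K0 * 2 ^ r"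
      using DK0[OF hyp] by blast
    have "int K0 * 2 ^ r \<le> int K * 2 ^ r" "real K0 * F (k + r) l \<le> real K * F (k + r) l"
      "real K0 * 2 ^ r \<le> real K * 2 ^ r"
      by (intro mult_right_mono; simp add: K_def nonneg)+
    then show ?thesis using l by (intro exI[of _ l]) linarith
  qed
  have K: "0 < K" by (simp add: K_def)
  \<comment> \<open>Multiplicity of the double counting: at most \<open>K\<^sup>2\<close> values of
    \<open>r\<close> by \<open>dyadic_window\<close>, and \<open>2 * K + 1\<close> values of
    \<open>l\<close> for each.\<close>
  define m where "m = K\<^sup>2 * (2 * K + 1)"
  have m: "0 < m" using K by (simp add: m_def)
  \<comment> \<open>Large enough for \<open>N / K * (T / 2)\<close> to beat
    \<open>m * (A * T)\<close>, and for truncation at \<open>2 ^ N\<close> not to affect whether a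
    value is at most \<open>B\<close>.\<close>
  define N where "N = nat \<lceil>2 * real K * m * A + B\<rceil> + 1"
  have N: "2 * real K * m * A < N" "B < 2 ^ N"
  proof -
    have *: "0 \<le> 2 * real K * m * A" "0 \<le> B" using A by (auto simp: B_def)
    have "2 * real K * m * A + B < N" unfolding N_def by linarith
    moreover have "real N < 2 ^ N" by (rule of_nat_less_two_power)
    ultimately show "2 * real K * m * A < N" "B < 2 ^ N" using * by linarith+
  qed
  \<comment> \<open>The levels cut off at both ends cost \<open>N + D\<close> and the rims
    \<open>4 * K\<close>, together \<open>T / 4\<close>; bad nodes and bad ancestors cost
    \<open>T / 8\<close> each. Half of \<open>T\<close> remains.\<close>
  define T where "T = 4 * (N + D + 4 * K)"
  have T: "0 < T" using K by (simp add: T_def)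
  define f where "f = (\<lambda>k i. min (F k i) (2 ^ N))"
  have f0: "0 \<le> f k i" for k i by (simp add: f_def nonneg)
  have fB: "F k i \<le> B" if "f k i \<le> B" for k i using that N by (auto simp: f_def min_def split: if_splits)
  have "A * T \<le> tree_mean T f k i" for k i
  proof (rule ccontr)
    assume "\<not> A * T \<le> tree_mean T f k i"
    then have less: "tree_mean T f k i < A * T" by simp
    define bad where "bad j = {l \<in> descendants j i. \<not> f (k + j) l \<le> B}" for j
    define b where "b j = card (bad j) / 2 ^ j" for j
    have fin: "finite {l \<in> descendants j i. P l}" for j P
      by (rule finite_subset[OF Collect_restrict finite_atLeastLessThan_int])
    have sum_b: "(\<Sum>j<T. b j) < T / 8"
    proof -
      have "B * b j \<le> (\<Sum>l\<in>descendants j i. f (k + j) l) / 2 ^ j" for j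
      proof -
        have "real (card (bad j)) * B = (\<Sum>l\<in>bad j. B)" by simp
        also have "\<dots> \<le> (\<Sum>l\<in>bad j. f (k + j) l)" by (intro sum_mono) (auto simp: bad_def)
        also have "\<dots> \<le> (\<Sum>l\<in>descendants j i. f (k + j) l)"
          by (intro sum_mono2) (auto simp: bad_def f0)
        finally show ?thesis by (simp add: b_def divide_right_mono mult.commute)
      qed
      then have "(\<Sum>j<T. B * b j) \<le> tree_mean T f k i"
        unfolding tree_mean_sum by (intro sum_mono)
      then have "B * (\<Sum>j<T. b j) < A * T" using less by (simp add: sum_distrib_left)
      then show ?thesis using A by (simp add: B_def)
    qed
    have b0: "0 \<le> b j" for j by (simp add: b_def)
    \<comment> \<open>Leaves room for the ancestor \<open>D\<close> levels up and for targets fewer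
      than \<open>N\<close> levels down.\<close>
    define J where "J = {D..<T - N}"
    \<comment> \<open>The last condition keeps \<open>l\<close> at distance \<open>K\<close> from
      both ends of its level, so that the targets found by spreading are again descendants of
      \<open>(k, i)\<close>.\<close>
    define good where "good j = {l \<in> descendants j i. f (k + j) l \<le> B \<and> f (k + (j - D)) (l div 2 ^ D) \<le> B
        \<and> i * 2 ^ j \<le> l - K \<and> l + K < (i + 1) * 2 ^ j}" for j
    have good_ge: "1 - b j - b (j - D) - 2 * K / 2 ^ j \<le> card (good j) / 2 ^ j" if "D \<le> j" for j
    proof -
      define bad' where "bad' = {l \<in> descendants j i. \<not> f (k + (j - D)) (l div 2 ^ D) \<le> B}"
      define rim where "rim = {i * 2 ^ j..<i * 2 ^ j + K} \<union> {(i + 1) * 2 ^ j - K..<(i + 1) * 2 ^ j}"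
      have "real (card (descendants j i)) - card (bad j) - card bad' - card rim \<le> card (good j)"
      proof (rule card_ge_of_cover)
        show "descendants j i \<subseteq> good j \<union> bad j \<union> bad' \<union> rim"
          by (auto simp: good_def bad_def bad'_def rim_def)
      qed (use fin in \<open>simp_all add: good_def bad_def bad'_def rim_def\<close>)
      moreover have "real (card (descendants j i)) = 2 ^ j"
      proof -
        have "(i + 1) * 2 ^ j - i * 2 ^ j = 2 ^ j" by (simp add: algebra_simps)
        then show ?thesis unfolding card_atLeastLessThan_int by (simp add: nat_power_eq)
      qed
      moreover have "card bad' \<le> 2 ^ D * card (bad (j - D))"
        using card_descendants_div_le[where j = "j - D" and D = D and i = i and P = "\<lambda>l. \<not> f (k + (j - D)) l \<le> B"] that
        by (simp add: bad'_def bad_def)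
      then have "real (card bad') \<le> 2 ^ D * real (card (bad (j - D)))"
        by (metis of_nat_le_iff of_nat_mult of_nat_numeral of_nat_power)
      moreover have "card rim \<le> 2 * K"
      proof -
        have "card rim \<le> card {i * 2 ^ j..<i * 2 ^ j + K} + card {(i + 1) * 2 ^ j - K..<(i + 1) * 2 ^ j}"
          unfolding rim_def by (rule card_Un_le)
        then show ?thesis by simp
      qed
      ultimately have "2 ^ j - real (card (bad j)) - 2 ^ D * real (card (bad (j - D))) - 2 * real K \<le> real (card (good j))"
        by linarith
      then have "(2 ^ j - real (card (bad j)) - 2 ^ D * real (card (bad (j - D))) - 2 * real K) / 2 ^ j \<le> real (card (good j)) / 2 ^ j"
        by (rule divide_right_mono) simp
      moreover have "2 ^ D * card (bad (j - D)) / 2 ^ j = b (j - D)"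
        using that by (simp add: b_def power_diff)
      ultimately show ?thesis by (simp add: diff_divide_distrib b_def)
    qed
    have sum_good: "T / 2 \<le> (\<Sum>j\<in>J. card (good j) / 2 ^ j)"
    proof -
      have "(\<Sum>j\<in>J. 1 - b j - b (j - D) - 2 * real K * (1 / 2) ^ j) \<le> (\<Sum>j\<in>J. card (good j) / 2 ^ j)"
        by (intro sum_mono) (use good_ge in \<open>auto simp: J_def power_divide\<close>)
      moreover have "(\<Sum>j\<in>J. b j) \<le> (\<Sum>j<T. b j)"
        by (intro sum_mono2) (auto simp: J_def b0)
      moreover have "(\<Sum>j\<in>J. b (j - D)) \<le> (\<Sum>j<T. b j)"
      proof -
        have "(\<Sum>j\<in>J. b (j - D)) = (\<Sum>j\<in>(\<lambda>j. j - D) ` J. b j)"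
          by (subst sum.reindex) (auto simp: J_def inj_on_def)
        also have "\<dots> \<le> (\<Sum>j<T. b j)"
          by (intro sum_mono2) (auto simp: J_def b0)
        finally show ?thesis .
      qed
      \<comment> \<open>The rim has at most \<open>2 * K\<close> nodes on every level, so its
        densities are dominated by a geometric series.\<close>
      moreover have "(\<Sum>j\<in>J. (1 / 2 :: real) ^ j) \<le> 2"
      proof -
        have "(\<Sum>j\<in>J. (1 / 2 :: real) ^ j) \<le> (\<Sum>j. (1 / 2) ^ j)"
          by (intro sum_le_suminf) (auto simp: J_def)
        then show ?thesis by (simp add: suminf_geometric)
      qed
      then have "2 * real K * (\<Sum>j\<in>J. (1 / 2 :: real) ^ j) \<le> 2 * real K * 2"
        by (intro mult_left_mono) auto
      moreover have "real (card J) = real T - N - D" by (simp add: J_def T_def)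
      ultimately have "real T - N - D - real T / 8 - real T / 8 - 4 * real K \<le> (\<Sum>j\<in>J. card (good j) / 2 ^ j)"
        using sum_b by (simp add: sum_subtractf flip: sum_distrib_left)
      moreover have "real T - N - D - real T / 8 - real T / 8 - 4 * real K = T / 2"
        by (simp add: T_def field_simps)
      ultimately show ?thesis by simp
    qed
    define c where "c j l r = (SOME l'. \<bar>l' - l * 2 ^ r\<bar> \<le> int K * 2 ^ r \<and> 2 ^ r \<le> real K * F (k + j + r) l' \<and>
        F (k + j + r) l' \<le> real K * 2 ^ r)" for j l r
    have c: "\<bar>c j l r - l * 2 ^ r\<bar> \<le> int K * 2 ^ r" "2 ^ r \<le> real K * F (k + j + r) (c j l r)"
        "F (k + j + r) (c j l r) \<le> real K * 2 ^ r" if "D \<le> j" "l \<in> good j" for j l r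
    proof -
      have "\<exists>l'. \<bar>l' - l * 2 ^ r\<bar> \<le> int K * 2 ^ r \<and> 2 ^ r \<le> real K * F (k + j + r) l' \<and> F (k + j + r) l' \<le> real K * 2 ^ r"
        using that by (intro DK) (auto simp: good_def fB)
      from someI_ex[OF this] show "\<bar>c j l r - l * 2 ^ r\<bar> \<le> int K * 2 ^ r" "2 ^ r \<le> real K * F (k + j + r) (c j l r)"
        "F (k + j + r) (c j l r) \<le> real K * 2 ^ r" unfolding c_def by blast+
    qed
    \<comment> \<open>Double counting: the good nodes \<open>(j, l)\<close> and \<open>r < N\<close> yield nodes \<open>(j + r, c j l r)\<close> of weight \<open>1 / 2 ^ (j + r)\<close>
      and value about \<open>2\<^sup>r\<close>, each of them at most \<open>m\<close> times.\<close>
    define S where "S = (SIGMA j:J. good j \<times> {..<N})"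
    define W where "W = (SIGMA j:{..<T}. descendants j i)"
    define h where "h = (\<lambda>(j, l). f (k + j) l / 2 ^ j)"
    define g where "g = (\<lambda>(j, l, r). (j + r, c j l r))"
    have fin_good: "finite (good j)" for j unfolding good_def by (rule fin)
    have fin_S: "finite S" unfolding S_def J_def using fin_good by (intro finite_SigmaI) auto
    have "(\<Sum>s\<in>S. h (g s)) \<le> m * (\<Sum>w\<in>W. h w)"
    proof (rule sum_fibre_card_le[OF fin_S])
      show "finite W" unfolding W_def by auto
      show "0 \<le> h w" for w by (auto simp: h_def f0 split: prod.split)
      show "g ` S \<subseteq> W"
      proof -
        have "c j l r \<in> descendants (j + r) i" if "D \<le> j" "l \<in> good j" for j l r
        proof -
          have "i * 2 ^ j * 2 ^ r \<le> (l - K) * 2 ^ r" "(l + K + 1) * 2 ^ r \<le> (i + 1) * 2 ^ j * 2 ^ r"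
            using that(2) by (auto simp: good_def intro!: mult_right_mono)
          moreover have "(0::int) < 2 ^ r" by simp
          moreover have "i * 2 ^ (j + r) = i * 2 ^ j * 2 ^ r" "(i + 1) * 2 ^ (j + r) = (i + 1) * 2 ^ j * 2 ^ r"
            by (simp_all add: power_add)
          moreover have "(l - K) * 2 ^ r = l * 2 ^ r - int K * 2 ^ r" "(l + K + 1) * 2 ^ r = l * 2 ^ r + int K * 2 ^ r + 2 ^ r"
            by (simp_all add: algebra_simps)
          ultimately show ?thesis using c(1)[OF that, of r] unfolding atLeastLessThan_iff abs_le_iff
            by linarith
        qed
        then show ?thesis by (auto simp: S_def W_def g_def J_def)
      qed
      show "card {s \<in> S. g s = w} \<le> m" if "w \<in> W" for w
      proof -
        obtain j' l' where w: "w = (j', l')" by (cases w)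
        obtain r0 where r0: "{r. 2 ^ r \<le> real K * F (k + j') l' \<and> F (k + j') l' \<le> real K * 2 ^ r} \<subseteq> {r0..<r0 + K\<^sup>2}"
          using dyadic_window[OF K] by blast
        \<comment> \<open>Since \<open>j = j' - r\<close>, an element of the fibre is determined by
          \<open>(r, l)\<close>; the value at the target confines \<open>r\<close> to a window, and
          the position of the target confines \<open>l\<close>.\<close>
        let ?X = "SIGMA r:{r0..<r0 + K\<^sup>2}. {l' div 2 ^ r - K..l' div 2 ^ r + K}"
        have "inj_on (\<lambda>(j, l, r). (r, l)) {s \<in> S. g s = w}"
          by (auto simp: inj_on_def g_def w)
        moreover have "(\<lambda>(j, l, r). (r, l)) ` {s \<in> S. g s = w} \<subseteq> ?X"
        proof -
          have "r \<in> {r0..<r0 + K\<^sup>2} \<and> l \<in> {l' div 2 ^ r - K..l' div 2 ^ r + K}"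
            if "D \<le> j" "l \<in> good j" "j + r = j'" "c j l r = l'" for j l r
          proof -
            note c = c[OF that(1,2), of r, unfolded that(4)]
            have "k + j + r = k + j'" using that(3) by simp
            then have r: "r \<in> {r0..<r0 + K\<^sup>2}" using c(2,3) r0 that(3) by (auto simp: add.assoc subset_iff)
            have l1: "l * 2 ^ r \<le> l' + int K * 2 ^ r" "l' - int K * 2 ^ r \<le> l * 2 ^ r"
              using c(1) unfolding abs_le_iff by linarith+
            from zdiv_mono1[OF l1(1), of "2 ^ r"] zdiv_mono1[OF l1(2), of "2 ^ r"]
            have "l \<le> l' div 2 ^ r + K" "l' div 2 ^ r - K \<le> l"
              using div_mult_self1[of "2 ^ r" l' "K"] div_mult_self1[of "2 ^ r" l' "- K"] by simp_all
            then show ?thesis using r by auto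
          qed
          then show ?thesis by (auto simp: S_def g_def w J_def)
        qed
        moreover have "finite ?X" by auto
        ultimately have "card {s \<in> S. g s = w} \<le> card ?X" by (rule card_inj_on_le)
        also have "card ?X = m"
          by (simp add: m_def nat_add_distrib nat_mult_distrib)
        finally show ?thesis .
      qed
    qed
    also have "(\<Sum>w\<in>W. h w) = tree_mean T f k i"
      unfolding W_def h_def tree_mean_sum by (simp add: sum.Sigma[symmetric] sum_divide_distrib)
    finally have upper: "(\<Sum>s\<in>S. h (g s)) \<le> m * tree_mean T f k i" .
    have "N / K * (\<Sum>j\<in>J. card (good j) / 2 ^ j) = (\<Sum>(j, l, r)\<in>S. 1 / (K * 2 ^ j))"
      unfolding S_def using fin_good
      by (subst sum.Sigma[symmetric])
         (auto simp: J_def card_cartesian_product sum_distrib_left sum.cartesian_product[symmetric] mult_ac)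
    also have "\<dots> \<le> (\<Sum>s\<in>S. h (g s))"
    proof (rule sum_mono, clarify)
      fix j l r assume "(j, l, r) \<in> S"
      then have jlr: "D \<le> j" "l \<in> good j" "r < N" by (auto simp: S_def J_def)
      \<comment> \<open>Truncation does no harm here, because \<open>2 ^ r / K\<close> is itself at
        most \<open>2 ^ N\<close>.\<close>
      have "2 ^ r / K \<le> f (k + (j + r)) (c j l r)"
      proof -
        have "2 ^ r / K \<le> F (k + j + r) (c j l r)" using c(2)[OF jlr(1,2), of r] K by (simp add: field_simps)
        moreover have "2 ^ r / real K \<le> 2 ^ r" using K by (simp add: field_simps)
        moreover have "(2::real) ^ r \<le> 2 ^ N" using jlr(3) by (intro power_increasing) auto
        ultimately show ?thesis unfolding f_def add.assoc by linarith
      qed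
      then have "2 ^ r / K / 2 ^ (j + r) \<le> f (k + (j + r)) (c j l r) / 2 ^ (j + r)"
        by (rule divide_right_mono) simp
      then show "1 / (K * 2 ^ j) \<le> h (g (j, l, r))"
        by (simp add: h_def g_def power_add field_simps)
    qed
    finally have "N / K * (\<Sum>j\<in>J. card (good j) / 2 ^ j) \<le> m * tree_mean T f k i" using upper by linarith
    moreover have "N / K * (T / 2) \<le> N / K * (\<Sum>j\<in>J. card (good j) / 2 ^ j)"
      by (intro mult_left_mono sum_good) simp
    moreover have "m * tree_mean T f k i < m * (A * T)"
      using less m by simp
    ultimately have "N / K * (T / 2) < m * (A * T)" by linarith
    moreover have "m * (A * T) < N / K * (T / 2)"
    proof -
      have "2 * real K * m * A * T < N * T" using N(1) T by simp
      then show ?thesis using K by (simp add: field_simps)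
    qed
    ultimately show False by linarith
  qed
  then show ?thesis using that T unfolding f_def by blast
qed

text \<open>Cut a branch into blocks of \<open>T\<close> levels. From every node a block has mean at
  least \<open>4 * A * T\<close>, so its Laplace transform is at most a fixed number below 1. Powers
  of this number control the measure of the branches whose sum is small after \<open>b\<close>
  blocks, and the Borel-Cantelli lemma applies.\<close>

theorem branch_sum_superlinear:
  assumes nonneg: "\<And>k i. 0 \<le> F k i" and spread: "spreading F"
  shows "AE t in lborel. t \<in> {0..<1} \<longrightarrow> (\<forall>A. \<forall>\<^sub>F T in sequentially. A * real T \<le> branch_sum T F 0 t)"
proof -
  have "AE t in lborel. t \<in> {0..<1} \<longrightarrow> (\<forall>\<^sub>F T in sequentially. A * real T \<le> branch_sum T F 0 t)"
    if A: "0 < A" for A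
  proof -
    obtain N T :: nat where T: "0 < T" and mean: "\<And>k i. 4 * A * T \<le> tree_mean T (\<lambda>k i. min (F k i) (2 ^ N)) k i"
      by (rule tree_mean_ge[OF nonneg spread, of "4 * A"]) (use A in auto)
    define M :: real where "M = 2 ^ N"
    define f where "f = (\<lambda>k i. min (F k i) M)"
    have f: "0 \<le> f k i" "f k i \<le> M" "f k i \<le> F k i" for k i by (auto simp: f_def M_def nonneg)
    have M: "0 < M" by (simp add: M_def)
    define y where "y = A\<^sup>2 / M\<^sup>2"
    have y: "0 < y" using A M by (simp add: y_def)
    \<comment> \<open>With this \<open>c\<close> the linear term is \<open>4 * y\<close> and the
      quadratic error is \<open>y\<close>, so a block contributes the factor
      \<open>exp (- 3 * y)\<close>. The threshold \<open>2 * A * T\<close> per block costs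
      \<open>exp (2 * y)\<close>, which leaves the summable \<open>exp (- y) ^ b\<close>.\<close>
    define c where "c = A / (T * M\<^sup>2)"
    have c: "0 \<le> c" using A by (simp add: c_def)
    have laplace: "tree_laplace T c f k i \<le> exp (- 3 * y)" for k i
    proof -
      have "c * (4 * A * T) \<le> c * tree_mean T f k i"
        using mean[of k i] c by (intro mult_left_mono) (auto simp: f_def M_def)
      moreover have "c * (4 * A * T) = 4 * y" "(c * T * M)\<^sup>2 = y"
        using T M by (simp_all add: c_def y_def power2_eq_square field_simps)
      ultimately have "tree_laplace T c f k i \<le> 1 + - 3 * y"
        using tree_laplace_le[of f M c T k i, OF f(1,2) c] by simp
      also have "\<dots> \<le> exp (- 3 * y)" by (rule exp_ge_add_one_self)
      finally show ?thesis .
    qed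
    \<comment> \<open>Having \<open>2 * A\<close> in place of \<open>A\<close> pays for rounding
      \<open>n\<close> down to a multiple of \<open>T\<close>, which loses at most half once
      \<open>b\<close> is positive.\<close>
    define X where "X b = {t \<in> tree_cell 0 0. branch_sum (b * T) f 0 t \<le> 2 * A * (b * T)}" for b
    have X_sets: "X b \<in> sets lborel" for b
      unfolding X_def tree_cell_eq by measurable
    have X_le: "emeasure lborel (X b) \<le> ennreal (exp (- y) ^ b)" for b
    proof -
      have "emeasure lborel (X b) \<le> ennreal (exp (c * (2 * A * (b * T))) * tree_laplace (b * T) c f 0 0 / 2 ^ 0)"
        unfolding X_def by (rule emeasure_branch_sum_le[OF c])
      also have "exp (c * (2 * A * (b * T))) * tree_laplace (b * T) c f 0 0 / 2 ^ 0 \<le>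
          exp (2 * y) ^ b * exp (- 3 * y) ^ b"
      proof -
        have "c * (2 * A * (b * T)) = b * (2 * y)"
          using T M by (simp add: c_def y_def power2_eq_square field_simps)
        then have "exp (c * (2 * A * (b * T))) = exp (2 * y) ^ b" by (simp only: exp_of_nat_mult)
        then show ?thesis
          using tree_laplace_power_le[OF laplace, of b 0 0] by (auto intro: mult_left_mono)
      qed
      also have "exp (2 * y) ^ b * exp (- 3 * y) ^ b = exp (- y) ^ b"
        by (simp flip: power_mult_distrib exp_add)
      finally show ?thesis by (simp add: ennreal_leI)
    qed
    have "AE t in lborel. \<forall>\<^sub>F b in sequentially. t \<in> space lborel - X b"
    proof (rule borel_cantelli_AE1[OF X_sets])
      show "emeasure lborel (X b) < \<infinity>" for b
        using X_le[of b] by (rule le_less_trans) simp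
      show "summable (\<lambda>b. measure lborel (X b))"
      proof (rule summable_comparison_test')
        show "summable (\<lambda>b. exp (- y) ^ b)" using y by (intro summable_geometric) simp
        show "norm (measure lborel (X b)) \<le> exp (- y) ^ b" if "0 \<le> b" for b
          using X_le[of b] unfolding measure_def by (auto intro: enn2real_leI)
      qed
    qed
    then show ?thesis
    proof eventually_elim
      case (elim t)
      show ?case
      proof
        assume "t \<in> {0..<1}"
        then have "t \<in> tree_cell 0 0" by (simp add: tree_cell_eq)
        with elim obtain b0 where b0: "\<And>b. b0 \<le> b \<Longrightarrow> 2 * A * (b * T) < branch_sum (b * T) f 0 t"
          unfolding eventually_sequentially X_def by (force simp: not_le)
        show "\<forall>\<^sub>F n in sequentially. A * real n \<le> branch_sum n F 0 t"
          unfolding eventually_sequentially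
        proof (intro exI allI impI)
          fix n assume n: "Suc b0 * T \<le> n"
          define b where "b = n div T"
          have b: "Suc b0 \<le> b" using n T by (simp add: b_def less_eq_div_iff_mult_less_eq)
          have "n = b * T + n mod T" by (simp add: b_def)
          moreover have "n mod T < T" using T by simp
          moreover have "T \<le> b * T" using b by simp
          ultimately have n': "n \<le> 2 * (b * T)" "b * T \<le> n" by linarith+
          have "A * n \<le> A * real (2 * (b * T))"
            using n'(1) A by (intro mult_left_mono) (auto simp only: of_nat_le_iff less_imp_le)
          also have "\<dots> \<le> branch_sum (b * T) f 0 t" using b0[of b] b by simp
          also have "\<dots> \<le> branch_sum n f 0 t"
            unfolding branch_sum_def using n'(2) f(1) by (intro sum_mono2) auto
          also have "\<dots> \<le> branch_sum n F 0 t"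
            unfolding branch_sum_def by (intro sum_mono f)
          finally show "A * n \<le> branch_sum n F 0 t" .
        qed
      qed
    qed
  qed
  \<comment> \<open>Countably many slopes dominate all real \<open>A\<close>.\<close>
  then have "AE t in lborel. \<forall>A::nat. t \<in> {0..<1} \<longrightarrow>
      (\<forall>\<^sub>F T in sequentially. real (Suc A) * real T \<le> branch_sum T F 0 t)"
    unfolding AE_all_countable by simp
  then show ?thesis
  proof eventually_elim
    case (elim t)
    show ?case
    proof (intro impI allI)
      fix A :: real assume t: "t \<in> {0..<1}"
      obtain A' :: nat where "A \<le> A'" using real_arch_simple by blast
      then have "A \<le> Suc A'" by simp
      then have le: "A * real T \<le> real (Suc A') * real T" for T :: nat by (intro mult_right_mono) auto
      from elim t have "\<forall>\<^sub>F T in sequentially. real (Suc A') * real T \<le> branch_sum T F 0 t" by blast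
      then show "\<forall>\<^sub>F T in sequentially. A * real T \<le> branch_sum T F 0 t"
        by (rule eventually_mono) (rule order_trans[OF le])
    qed
  qed
qed

section \<open>Hyperbolic geometry of the disc\<close>

text \<open>This is \<open>cosh\<^sup>2 (d z w / 2)\<close> for the hyperbolic distance \<open>d\<close>, so it is comparable to \<open>exp (d z w)\<close>.\<close>

definition disc_sep :: "complex \<Rightarrow> complex \<Rightarrow> real" where
  "disc_sep z w = (cmod (1 - cnj z * w))\<^sup>2 / ((1 - (cmod z)\<^sup>2) * (1 - (cmod w)\<^sup>2))"

lemma one_minus_norm_sq_bounds:
  assumes "cmod z < 1"
  shows "0 < 1 - (cmod z)\<^sup>2" "1 - cmod z \<le> 1 - (cmod z)\<^sup>2" "1 - (cmod z)\<^sup>2 \<le> 2 * (1 - cmod z)"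
proof -
  have *: "1 - (cmod z)\<^sup>2 = (1 - cmod z) * (1 + cmod z)" by (simp add: power2_eq_square algebra_simps)
  show "0 < 1 - (cmod z)\<^sup>2" using assms unfolding * by (intro mult_pos_pos) (auto simp: add_pos_nonneg)
  show "1 - cmod z \<le> 1 - (cmod z)\<^sup>2" using assms mult_left_mono[of 1 "1 + cmod z" "1 - cmod z"] unfolding * by simp
  show "1 - (cmod z)\<^sup>2 \<le> 2 * (1 - cmod z)" using assms mult_left_mono[of "1 + cmod z" 2 "1 - cmod z"] unfolding * by simp
qed

lemma disc_sep_commute: "disc_sep z w = disc_sep w z"
proof -
  have "cmod (1 - cnj z * w) = cmod (cnj (1 - cnj z * w))" by (simp only: complex_mod_cnj)
  also have "\<dots> = cmod (1 - cnj w * z)" by (simp add: mult.commute)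
  finally show ?thesis by (simp add: disc_sep_def mult.commute)
qed

lemma disc_sep_0_left: "disc_sep 0 w = 1 / (1 - (cmod w)\<^sup>2)"
  by (simp add: disc_sep_def)

lemma norm_one_minus_cnj_mult_sq:
  "(cmod (1 - cnj z * w))\<^sup>2 = (1 - (cmod z)\<^sup>2) * (1 - (cmod w)\<^sup>2) + (cmod (z - w))\<^sup>2"
  unfolding cmod_power2 by (simp add: power2_eq_square algebra_simps)

lemma disc_sep_ge_1:
  assumes "cmod z < 1" "cmod w < 1" shows "1 \<le> disc_sep z w"
  using one_minus_norm_sq_bounds(1)[OF assms(1)] one_minus_norm_sq_bounds(1)[OF assms(2)]
  by (simp add: disc_sep_def norm_one_minus_cnj_mult_sq divide_simps)

text \<open>The square of \<open>cosh (a + b) \<le> 2 * cosh a * cosh b\<close> for half distances,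
  combined with the triangle inequality.\<close>

lemma disc_sep_triangle:
  assumes "cmod z < 1" "cmod u < 1" "cmod w < 1"
  shows "disc_sep z w \<le> 4 * disc_sep z u * disc_sep u w"
proof -
  have le: "cmod (z' - u) \<le> cmod (1 - cnj z' * u)" if "cmod z' < 1" for z'
  proof -
    have "(cmod (z' - u))\<^sup>2 \<le> (cmod (1 - cnj z' * u))\<^sup>2"
      unfolding norm_one_minus_cnj_mult_sq
      using one_minus_norm_sq_bounds(1)[OF that] one_minus_norm_sq_bounds(1)[OF assms(2)] by simp
    then show ?thesis by (rule power2_le_imp_le) simp
  qed
  have sw: "cmod (1 - cnj w * u) = cmod (1 - cnj u * w)"
    by (metis complex_cnj_cnj complex_cnj_diff complex_cnj_mult complex_cnj_one complex_mod_cnj mult.commute)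
  define U where "U = 1 - (cmod u)\<^sup>2"
  have pos: "0 < U" "0 < 1 - (cmod z)\<^sup>2" "0 < 1 - (cmod w)\<^sup>2"
    using one_minus_norm_sq_bounds(1) assms by (auto simp: U_def)
  \<comment> \<open>The disc version of the addition formula for \<open>cosh\<close>; by
    \<open>le\<close> the second product is at most the first in modulus.\<close>
  have "of_real U * (1 - cnj z * w) = (1 - cnj z * u) * (1 - cnj u * w) - cnj (z - u) * (w - u)"
  proof -
    have "complex_of_real U = 1 - u * cnj u"
      by (simp only: U_def of_real_diff of_real_1 complex_norm_square)
    then show ?thesis by (simp only:) (simp add: algebra_simps)
  qed
  then have "U * cmod (1 - cnj z * w) = cmod ((1 - cnj z * u) * (1 - cnj u * w) - cnj (z - u) * (w - u))"
    using pos by (metis abs_of_pos norm_mult norm_of_real)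
  also have "\<dots> \<le> cmod (1 - cnj z * u) * cmod (1 - cnj u * w) + cmod (z - u) * cmod (w - u)"
    by (metis complex_mod_cnj norm_mult norm_triangle_ineq4)
  also have "\<dots> \<le> cmod (1 - cnj z * u) * cmod (1 - cnj u * w) + cmod (1 - cnj z * u) * cmod (1 - cnj u * w)"
    using le[OF assms(1)] le[OF assms(3)] by (intro add_left_mono mult_mono) (auto simp: sw)
  finally have "(U * cmod (1 - cnj z * w))\<^sup>2 \<le> (2 * (cmod (1 - cnj z * u) * cmod (1 - cnj u * w)))\<^sup>2"
    using pos by (intro power_mono mult_nonneg_nonneg) (auto simp: mult.commute)
  then have "(cmod (1 - cnj z * w))\<^sup>2 \<le> 4 * (cmod (1 - cnj z * u))\<^sup>2 * (cmod (1 - cnj u * w))\<^sup>2 / U\<^sup>2"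
    using pos by (simp add: power_mult_distrib field_simps)
  then have "disc_sep z w \<le> (4 * (cmod (1 - cnj z * u))\<^sup>2 * (cmod (1 - cnj u * w))\<^sup>2 / U\<^sup>2) /
      ((1 - (cmod z)\<^sup>2) * (1 - (cmod w)\<^sup>2))"
    unfolding disc_sep_def using pos by (intro divide_right_mono) auto
  also have "\<dots> = 4 * disc_sep z u * disc_sep u w"
    by (simp only: disc_sep_def U_def[symmetric]) (simp add: power2_eq_square)
  finally show ?thesis .
qed

section \<open>The action on the disc and its derivative on the circle\<close>

lemma su_alpha_mult: "su_alpha (A ** B) = su_alpha A * su_alpha B + su_beta A * cnj (su_beta B)"
  and su_beta_mult: "su_beta (A ** B) = su_alpha A * su_beta B + su_beta A * cnj (su_alpha B)"
  by (simp_all add: su_alpha_def su_beta_def matrix_matrix_mult_def sum_2 complex_eq_iff field_simps)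

lemma su_alpha_one: "su_alpha (mat 1) = 1" and su_beta_one: "su_beta (mat 1) = 0"
  by (simp_all add: su_alpha_def su_beta_def mat_def complex_eq_iff)

lemma disc_act_one: "disc_act (mat 1) z = z"
  by (simp add: disc_act_def su_alpha_one su_beta_one)

text \<open>The automorphy factor: if \<open>det A = 1\<close>, the complex derivative of
  \<open>disc_act A\<close> at a point \<open>z\<close> of the closed disc is
  \<open>1 / (disc_den A z)\<^sup>2\<close>.\<close>

definition disc_den :: "real^2^2 \<Rightarrow> complex \<Rightarrow> complex" where
  "disc_den A z = cnj (su_beta A) * z + cnj (su_alpha A)"

lemma disc_act_eq: "disc_act A z = (su_alpha A * z + su_beta A) / disc_den A z"
  by (simp add: disc_act_def disc_den_def)

lemma disc_den_nonzero: "det A = 1 \<Longrightarrow> cmod z \<le> 1 \<Longrightarrow> disc_den A z \<noteq> 0"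
  unfolding disc_den_def by (rule disc_act_denom_nonzero)

lemma disc_act_mult:
  assumes "det A = 1" "det B = 1" "cmod z \<le> 1"
  shows "disc_act (A ** B) z = disc_act A (disc_act B z)"
proof -
  have d: "disc_den B z \<noteq> 0" by (rule disc_den_nonzero[OF assms(2,3)])
  have "su_alpha A * disc_act B z + su_beta A = (su_alpha (A ** B) * z + su_beta (A ** B)) / disc_den B z"
    "disc_den A (disc_act B z) = disc_den (A ** B) z / disc_den B z"
    using d by (simp_all add: disc_act_eq disc_den_def divide_simps su_alpha_mult su_beta_mult)
      (simp_all add: algebra_simps)
  then show ?thesis using d by (simp add: disc_act_eq[of A] disc_act_eq[of "A ** B"])
qed

text \<open>The matrix acts through \<open>SU(1,1)\<close>, which preserves a hermitian form; this
  is that invariance divided by the two automorphy factors. Invariance of the disc and of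
  \<open>disc_sep\<close> follows from it.\<close>

lemma one_minus_cnj_disc_act:
  assumes "det A = 1" "cmod z \<le> 1" "cmod w \<le> 1"
  shows "1 - cnj (disc_act A z) * disc_act A w = (1 - cnj z * w) / (cnj (disc_den A z) * disc_den A w)"
proof -
  have nz: "disc_den A z \<noteq> 0" "disc_den A w \<noteq> 0" using disc_den_nonzero assms by auto
  have "su_alpha A * cnj (su_alpha A) - su_beta A * cnj (su_beta A) = 1"
    using su_norm_diff[OF assms(1)] by (metis complex_norm_square of_real_1 of_real_diff)
  then have eq: "su_alpha A * cnj (su_alpha A) = 1 + su_beta A * cnj (su_beta A)" by (simp add: algebra_simps)
  have "cnj (disc_den A z) * disc_den A w - cnj (su_alpha A * z + su_beta A) * (su_alpha A * w + su_beta A)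
     = (su_alpha A * cnj (su_alpha A) - su_beta A * cnj (su_beta A)) * (1 - cnj z * w)"
    by (simp add: disc_den_def algebra_simps)
  also have "\<dots> = 1 - cnj z * w" by (simp add: eq)
  finally have "1 - cnj z * w = cnj (disc_den A z) * disc_den A w - cnj (su_alpha A * z + su_beta A) * (su_alpha A * w + su_beta A)" ..
  then show ?thesis
    using nz by (simp only: disc_act_eq complex_cnj_divide diff_divide_distrib) simp
qed

lemma one_minus_norm_sq_disc_act:
  assumes "det A = 1" "cmod z \<le> 1"
  shows "1 - (cmod (disc_act A z))\<^sup>2 = (1 - (cmod z)\<^sup>2) / (cmod (disc_den A z))\<^sup>2"
proof -
  have "complex_of_real (1 - (cmod (disc_act A z))\<^sup>2) = of_real ((1 - (cmod z)\<^sup>2) / (cmod (disc_den A z))\<^sup>2)"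
    using one_minus_cnj_disc_act[OF assms assms(2)]
    by (simp only: complex_norm_square mult.commute of_real_diff of_real_1 of_real_divide)
  then show ?thesis by (simp only: of_real_eq_iff)
qed

lemma norm_disc_act_less_1:
  assumes "det A = 1" "cmod z < 1" shows "cmod (disc_act A z) < 1"
proof -
  have "0 < 1 - (cmod (disc_act A z))\<^sup>2"
    using one_minus_norm_sq_bounds(1)[OF assms(2)] disc_den_nonzero[OF assms(1), of z] assms
    by (simp add: one_minus_norm_sq_disc_act)
  then show ?thesis by (simp add: power_less_one_iff)
qed

lemma disc_sep_disc_act:
  assumes "det A = 1" "cmod z < 1" "cmod w < 1"
  shows "disc_sep (disc_act A z) (disc_act A w) = disc_sep z w"
  using assms disc_den_nonzero[OF assms(1), of z] disc_den_nonzero[OF assms(1), of w]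
  unfolding disc_sep_def
  by (simp add: one_minus_norm_sq_disc_act one_minus_cnj_disc_act norm_divide norm_mult power_divide power_mult_distrib)

text \<open>On the circle the numerator of \<open>disc_act A p\<close> is
  \<open>p * cnj (disc_den A p)\<close>, so the quotient inside \<open>Arg\<close> equals 1 at
  \<open>t = 0\<close> and has velocity \<open>\<i> / of_real d\<close> there. \<open>Ln\<close> has
  derivative 1 at 1, and \<open>Arg\<close> is its imaginary part away from 0.\<close>

lemma circle_deriv_eq:
  assumes "det A = 1" "cmod p = 1"
  shows "circle_deriv A p = 1 / (cmod (disc_den A p))\<^sup>2"
proof -
  define d where "d = (cmod (disc_den A p))\<^sup>2"
  have nz: "disc_den A p \<noteq> 0" using disc_den_nonzero assms by auto
  have pp: "p * cnj p = 1" using assms(2) by (metis complex_norm_square of_real_1 one_power2)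
  have p0: "p \<noteq> 0" using assms(2) by auto
  have num: "su_alpha A * p + su_beta A = p * cnj (disc_den A p)"
    using pp by (simp add: disc_den_def algebra_simps)
  have dd: "disc_den A p * cnj (disc_den A p) = of_real d" unfolding d_def by (rule complex_norm_square[symmetric])
  have act0: "disc_act A p \<noteq> 0" using nz p0 num by (simp add: disc_act_eq)
  have det': "su_alpha A * cnj (su_alpha A) - su_beta A * cnj (su_beta A) = 1"
    using su_norm_diff[OF assms(1)] by (metis complex_norm_square of_real_1 of_real_diff)
  have D: "(disc_act A has_field_derivative 1 / (disc_den A p)\<^sup>2) (at p)"
  proof -
    have "((\<lambda>z. (su_alpha A * z + su_beta A) / disc_den A z) has_field_derivative
        (su_alpha A * disc_den A p - (su_alpha A * p + su_beta A) * cnj (su_beta A)) / (disc_den A p * disc_den A p)) (at p)"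
      using nz unfolding disc_den_def by (auto intro!: derivative_eq_intros)
    moreover have "su_alpha A * disc_den A p - (su_alpha A * p + su_beta A) * cnj (su_beta A) = 1"
      using det' by (simp add: disc_den_def algebra_simps)
    ultimately show ?thesis unfolding disc_act_eq[abs_def] by (simp add: power2_eq_square)
  qed
  have "((\<lambda>t. p * cis t) has_vector_derivative \<i> * p) (at 0)"
    unfolding has_vector_derivative_def
    by (auto intro!: derivative_eq_intros simp: scaleR_conv_of_real mult_ac)
  then have "((disc_act A \<circ> (\<lambda>t. p * cis t)) has_vector_derivative (\<i> * p) * (1 / (disc_den A p)\<^sup>2)) (at 0)"
    by (rule field_vector_diff_chain_at) (use D in simp)
  then have "((\<lambda>t. disc_act A (p * cis t) / disc_act A p) has_vector_derivative
      (\<i> * p) * (1 / (disc_den A p)\<^sup>2) / disc_act A p) (at 0)"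
    unfolding o_def by (rule has_vector_derivative_divide)
  moreover have "(\<i> * p) * (1 / (disc_den A p)\<^sup>2) / disc_act A p = \<i> / of_real d"
    using nz p0 unfolding disc_act_eq num dd[symmetric] by (simp add: power2_eq_square)
  ultimately have quot: "((\<lambda>t. disc_act A (p * cis t) / disc_act A p) has_vector_derivative \<i> / of_real d) (at 0)"
    by simp
  have "((Ln \<circ> (\<lambda>t. disc_act A (p * cis t) / disc_act A p)) has_vector_derivative (\<i> / of_real d) * 1) (at 0)"
  proof (rule field_vector_diff_chain_at[OF quot])
    show "(Ln has_field_derivative 1) (at (disc_act A (p * cis 0) / disc_act A p))"
      using act0 has_field_derivative_Ln[of 1] by simp
  qed
  then have "((\<lambda>t. Im (Ln (disc_act A (p * cis t) / disc_act A p))) has_vector_derivative Im (\<i> / of_real d)) (at 0)"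
    using bounded_linear.has_vector_derivative[OF bounded_linear_Im] by (fastforce simp: o_def)
  moreover have "Im (\<i> / complex_of_real d) = 1 / d"
    by (simp add: Im_divide_of_real)
  ultimately have deriv: "((\<lambda>t. Im (Ln (disc_act A (p * cis t) / disc_act A p))) has_real_derivative 1 / d) (at 0)"
    by (simp add: has_real_derivative_iff_has_vector_derivative)
  have "disc_act A (p * cis t) \<noteq> 0" for t
  proof -
    have n: "cmod (p * cis t) = 1" by (simp add: norm_mult assms(2))
    have "1 - (cmod (disc_act A (p * cis t)))\<^sup>2 = 0"
      using one_minus_norm_sq_disc_act[OF assms(1), of "p * cis t"] n by simp
    then show ?thesis by auto
  qed
  then have "Arg (disc_act A (p * cis t) / disc_act A p) = Im (Ln (disc_act A (p * cis t) / disc_act A p))" for t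
    using act0 by (simp add: Arg_eq_Im_Ln)
  then have "((\<lambda>t. Arg (disc_act A (p * cis t) / disc_act A p)) has_real_derivative 1 / d) (at 0)"
    using deriv by simp
  then show ?thesis unfolding circle_deriv_def d_def by (rule DERIV_imp_deriv)
qed

text \<open>The right-hand side is the Poisson kernel of the preimage \<open>a\<close> of the
  centre; it comes from \<open>one_minus_cnj_disc_act\<close> at \<open>p\<close> and
  \<open>a\<close>, where the left-hand side is 1. A large derivative at \<open>p\<close> thus means
  that \<open>a\<close> is close to \<open>p\<close>.\<close>

lemma disc_act_zero_imp:
  assumes "det A = 1" "cmod a < 1" "disc_act A a = 0" "cmod p = 1"
  shows "circle_deriv A p = (1 - (cmod a)\<^sup>2) / (cmod (p - a))\<^sup>2"
proof -
  have "1 - cnj (disc_act A p) * disc_act A a = (1 - cnj p * a) / (cnj (disc_den A p) * disc_den A a)"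
    using assms by (intro one_minus_cnj_disc_act) auto
  then have "cmod (1 - cnj p * a) = cmod (disc_den A p) * cmod (disc_den A a)"
    using disc_den_nonzero[OF assms(1), of p] disc_den_nonzero[OF assms(1), of a] assms
    by (simp add: divide_simps norm_mult) (metis complex_mod_cnj norm_mult)
  moreover have "cmod (p - a) = cmod (1 - cnj p * a)"
  proof -
    have "p * cnj p = 1" using assms(4) by (metis complex_norm_square of_real_1 one_power2)
    then have "p - a = p * (1 - cnj p * a)" by (simp add: algebra_simps)
    then show ?thesis by (metis assms(4) mult_1 norm_mult)
  qed
  moreover have "1 - (cmod a)\<^sup>2 = (cmod (disc_den A a))\<^sup>2"
    using one_minus_norm_sq_disc_act[OF assms(1), of a] assms by simp
  ultimately show ?thesis
    using one_minus_norm_sq_bounds(1)[OF assms(2)] assms(1,4)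
    by (simp add: circle_deriv_eq power_mult_distrib)
qed

section \<open>Chords and angles on the circle\<close>

lemma norm_cis_minus_one: "cmod (cis a - 1) = 2 * \<bar>sin (a / 2)\<bar>"
proof -
  have "(cmod (cis a - 1))\<^sup>2 = (cos a - 1)\<^sup>2 + (sin a)\<^sup>2" by (simp add: cmod_power2)
  also have "\<dots> = 2 * (1 - cos a)" using sin_cos_squared_add[of a] by (simp add: power2_eq_square algebra_simps)
  also have "\<dots> = (2 * \<bar>sin (a / 2)\<bar>)\<^sup>2" using cos_double_sin[of "a / 2"] by (simp add: power_mult_distrib)
  finally show ?thesis by (rule power2_eq_imp_eq) auto
qed

lemma norm_cis_diff: "cmod (cis a - cis b) = 2 * \<bar>sin ((a - b) / 2)\<bar>"
proof -
  have "cis a - cis b = cis b * (cis (a - b) - 1)" by (simp add: algebra_simps cis_mult)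
  then show ?thesis by (simp only: norm_mult norm_cis norm_cis_minus_one mult_1)
qed

lemma norm_cis_diff_le: "cmod (cis a - cis b) \<le> \<bar>a - b\<bar>"
  unfolding norm_cis_diff using abs_sin_x_le_abs_x[of "(a - b) / 2"] by simp

text \<open>Jordan's inequality: by concavity, the sine lies above its chord from \<open>0\<close>
  to \<open>pi / 2\<close>.\<close>

lemma sin_ge_chord:
  assumes "0 \<le> x" "x \<le> pi / 2" shows "2 / pi * x \<le> sin x"
proof -
  have "convex_on {0..pi / 2} (\<lambda>x. - sin x)"
  proof (rule f''_ge0_imp_convex)
    show "((\<lambda>x. - sin x) has_real_derivative - cos x) (at x)" for x by (auto intro!: derivative_eq_intros)
    show "((\<lambda>x. - cos x) has_real_derivative sin x) (at x)" for x by (auto intro!: derivative_eq_intros)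
    show "0 \<le> sin x" if "x \<in> {0..pi / 2}" for x using that by (intro sin_ge_zero) auto
    show "convex {0..pi / 2}" by simp
  qed
  from convex_onD[OF this, of "2 / pi * x" 0 "pi / 2"] show ?thesis
    using assms by (simp add: field_simps)
qed

lemma angle_le_chord:
  assumes "\<bar>a\<bar> \<le> pi" shows "\<bar>a\<bar> \<le> pi / 2 * cmod (cis a - 1)"
proof -
  have "2 / pi * \<bar>a / 2\<bar> \<le> sin \<bar>a / 2\<bar>" using assms by (intro sin_ge_chord) auto
  also have "\<dots> \<le> \<bar>sin (a / 2)\<bar>" by (cases "0 \<le> a") auto
  finally show ?thesis unfolding norm_cis_minus_one by (simp add: field_simps)
qed

text \<open>Angles are measured in turns. Taking the argument of \<open>w / p\<close> rather than of
  \<open>w\<close> yields the representative close to \<open>t\<close>; the constant is the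
  \<open>pi / 2\<close> of \<open>angle_le_chord\<close> divided by \<open>2 * pi\<close>.\<close>

lemma exists_angle_near:
  assumes "p = cis (2 * pi * t)"
  obtains x where "w = of_real (cmod w) * cis (2 * pi * x)"
    "\<bar>x - t\<bar> \<le> (cmod (p - w) + \<bar>1 - cmod w\<bar>) / 4"
proof -
  define a where "a = (if w = 0 then 0 else Arg (w / p))"
  have p: "cmod p = 1" "p \<noteq> 0" using assms by auto
  have a: "\<bar>a\<bar> \<le> pi" using Arg_bounded[of "w / p"] by (auto simp: a_def)
  have eq: "w = of_real (cmod w) * cis a * p"
  proof (cases "w = 0")
    case False
    then have "w / p = of_real (cmod (w / p)) * cis a"
      using rcis_cmod_Arg[of "w / p"] by (simp add: a_def rcis_def)
    then show ?thesis using p by (simp add: norm_divide field_simps)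
  qed simp
  have "cmod (cis a - 1) = cmod (cis a * p - p)"
    using p by (metis mult_1 mult.right_neutral norm_mult left_diff_distrib)
  also have "\<dots> \<le> cmod (cis a * p - w) + cmod (w - p)"
    using norm_triangle_ineq[of "cis a * p - w" "w - p"] by simp
  also have "cis a * p - w = of_real (1 - cmod w) * (cis a * p)"
    by (subst eq) (simp add: algebra_simps)
  finally have "cmod (cis a - 1) \<le> \<bar>1 - cmod w\<bar> + cmod (p - w)"
    by (simp only: norm_mult norm_cis p norm_of_real norm_minus_commute) simp
  then have "pi / 2 * cmod (cis a - 1) \<le> pi / 2 * (\<bar>1 - cmod w\<bar> + cmod (p - w))"
    by (intro mult_left_mono) auto
  with angle_le_chord[OF a] have "\<bar>a\<bar> \<le> pi / 2 * (\<bar>1 - cmod w\<bar> + cmod (p - w))" by linarith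
  then have "\<bar>a / (2 * pi)\<bar> \<le> (cmod (p - w) + \<bar>1 - cmod w\<bar>) / 4" by (simp add: field_simps)
  moreover have "w = of_real (cmod w) * cis (2 * pi * (t + a / (2 * pi)))"
    by (subst eq) (simp add: assms cis_mult distrib_left add.commute)
  ultimately show ?thesis by (intro that[of "t + a / (2 * pi)"]) simp_all
qed

section \<open>Distance to an orbit\<close>

interpretation SL2R: group SL2R by (rule group_SL2R)

locale SL2R_subgroup =
  fixes G :: "(real^2^2) set"
  assumes subgroup_SL2R: "subgroup G SL2R"
begin

lemma det_eq_1: "g \<in> G \<Longrightarrow> det g = 1"
  using subgroup.subset[OF subgroup_SL2R] by (auto simp: SL2R_def)

lemma one_mem: "mat 1 \<in> G"
  using subgroup.one_closed[OF subgroup_SL2R] by (simp add: SL2R_def)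

lemma mult_mem: "g \<in> G \<Longrightarrow> h \<in> G \<Longrightarrow> g ** h \<in> G"
  using subgroup.m_closed[OF subgroup_SL2R] by (simp add: SL2R_def)

lemma obtain_inverse:
  assumes "g \<in> G"
  obtains h where "h \<in> G" "g ** h = mat 1" "h ** g = mat 1"
proof -
  have c: "g \<in> carrier SL2R" using assms subgroup.subset[OF subgroup_SL2R] by auto
  have "m_inv SL2R g \<in> G" using subgroup.m_inv_closed[OF subgroup_SL2R assms] .
  moreover have "g ** m_inv SL2R g = mat 1" "m_inv SL2R g ** g = mat 1"
    using SL2R.r_inv[OF c] SL2R.l_inv[OF c] by (simp_all add: SL2R_def)
  ultimately show ?thesis by (rule that)
qed

text \<open>In the disc this is, within a factor of 4, the exponential of the hyperbolic distance
  from \<open>z\<close> to the orbit of the centre.\<close>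

definition orbit_sep :: "complex \<Rightarrow> real" where
  "orbit_sep z = (INF g\<in>G. disc_sep z (disc_act g 0))"

lemma act_0_less_1: "g \<in> G \<Longrightarrow> cmod (disc_act g 0) < 1"
  by (intro norm_disc_act_less_1 det_eq_1) auto

lemma orbit_sep_le:
  assumes "cmod z < 1" "g \<in> G"
  shows "orbit_sep z \<le> disc_sep z (disc_act g 0)"
  unfolding orbit_sep_def
proof (rule cINF_lower)
  show "bdd_below ((\<lambda>g. disc_sep z (disc_act g 0)) ` G)"
    by (rule bdd_belowI2[where m = 1]) (use assms disc_sep_ge_1 act_0_less_1 in auto)
qed (rule assms)

lemma orbit_sep_ge_1:
  assumes "cmod z < 1" shows "1 \<le> orbit_sep z"
  unfolding orbit_sep_def
  by (rule cINF_greatest) (use assms one_mem disc_sep_ge_1 act_0_less_1 in auto)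

text \<open>The infimum is at least 1, so its double is strictly larger and some orbit point stays
  below the double.\<close>

lemma orbit_sep_near:
  assumes "cmod z < 1"
  obtains g where "g \<in> G" "disc_sep z (disc_act g 0) \<le> 2 * orbit_sep z"
proof -
  have "orbit_sep z < 2 * orbit_sep z" using orbit_sep_ge_1[OF assms] by simp
  then obtain g where "g \<in> G" "disc_sep z (disc_act g 0) < 2 * orbit_sep z"
    using cInf_lessD[of "(\<lambda>g. disc_sep z (disc_act g 0)) ` G" "2 * orbit_sep z"] one_mem
    unfolding orbit_sep_def by auto
  then show ?thesis by (intro that[of g]) auto
qed

lemma orbit_sep_le_mult:
  assumes "cmod z < 1" "cmod w < 1"
  shows "orbit_sep z \<le> 4 * disc_sep z w * orbit_sep w"
proof -
  have pos: "0 < 4 * disc_sep z w" using disc_sep_ge_1[OF assms] by simp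
  have "orbit_sep z / (4 * disc_sep z w) \<le> orbit_sep w"
    unfolding orbit_sep_def[of w]
  proof (rule cINF_greatest)
    show "G \<noteq> {}" using one_mem by auto
    fix g assume g: "g \<in> G"
    have "orbit_sep z \<le> 4 * disc_sep z w * disc_sep w (disc_act g 0)"
      using orbit_sep_le[OF assms(1) g] disc_sep_triangle[OF assms act_0_less_1[OF g]] by linarith
    then show "orbit_sep z / (4 * disc_sep z w) \<le> disc_sep w (disc_act g 0)"
      using pos by (simp add: pos_divide_le_eq mult.commute)
  qed
  then show ?thesis using pos by (simp add: pos_divide_le_eq mult.commute)
qed

lemma act_inverse:
  assumes "g \<in> G" "h \<in> G" "g ** h = mat 1" "cmod z \<le> 1"
  shows "disc_act g (disc_act h z) = z"
  using disc_act_mult[of g h z] assms det_eq_1 by (simp add: disc_act_one)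

lemma orbit_sep_act_le:
  assumes "cmod z < 1" "g \<in> G"
  shows "orbit_sep (disc_act g z) \<le> orbit_sep z"
  unfolding orbit_sep_def[of z]
proof (rule cINF_greatest)
  show "G \<noteq> {}" using one_mem by auto
  fix h assume h: "h \<in> G"
  have "orbit_sep (disc_act g z) \<le> disc_sep (disc_act g z) (disc_act (g ** h) 0)"
    using assms h by (intro orbit_sep_le norm_disc_act_less_1 mult_mem det_eq_1)
  also have "\<dots> = disc_sep z (disc_act h 0)"
    using assms h act_0_less_1 det_eq_1 by (simp add: disc_act_mult disc_sep_disc_act)
  finally show "orbit_sep (disc_act g z) \<le> disc_sep z (disc_act h 0)" .
qed

lemma orbit_sep_act:
  assumes "cmod z < 1" "g \<in> G"
  shows "orbit_sep (disc_act g z) = orbit_sep z"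
proof -
  obtain h where h: "h \<in> G" "g ** h = mat 1" "h ** g = mat 1" using obtain_inverse[OF assms(2)] .
  have "orbit_sep (disc_act h (disc_act g z)) \<le> orbit_sep (disc_act g z)"
    using assms h by (intro orbit_sep_act_le norm_disc_act_less_1 det_eq_1)
  then show ?thesis using orbit_sep_act_le[OF assms] act_inverse[of h g z] h assms by simp
qed

lemma disc_orbit_act:
  assumes "g \<in> G" "cmod z < 1"
  shows "disc_orbit G (disc_act g z) = disc_orbit G z"
proof -
  have sub: "disc_orbit G (disc_act g z) \<subseteq> disc_orbit G z" if "g \<in> G" "cmod z < 1" for g z
    unfolding disc_orbit_def orbit_def
    using that by (auto simp flip: disc_act_mult simp: det_eq_1 intro: mult_mem)
  obtain h where h: "h \<in> G" "h ** g = mat 1" using obtain_inverse[OF assms(1)] .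
  have "disc_orbit G (disc_act h (disc_act g z)) \<subseteq> disc_orbit G (disc_act g z)"
    using assms h by (intro sub norm_disc_act_less_1 det_eq_1)
  then show ?thesis using sub[OF assms] act_inverse[of h g z] h assms by simp
qed

text \<open>The group moves every point into one closed ball about the centre, so the orbit space is
  a continuous image of a compact set.\<close>

lemma cocompact_if_orbit_sep_bounded:
  assumes "\<And>u. cmod u < 1 \<Longrightarrow> orbit_sep u \<le> R"
  shows "cocompact G"
proof -
  have R: "1 \<le> R" using assms[of 0] orbit_sep_ge_1[of 0] by simp
  \<comment> \<open>The radius at which \<open>disc_sep 0\<close> takes the value
    \<open>2 * R\<close>, the factor 2 coming from \<open>orbit_sep_near\<close>.\<close>
  define \<rho> where "\<rho> = sqrt (1 - 1 / (2 * R))"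
  have \<rho>: "\<rho>\<^sup>2 = 1 - 1 / (2 * R)" "0 \<le> \<rho>" using R by (auto simp: \<rho>_def field_simps)
  have "\<rho>\<^sup>2 < 1\<^sup>2" using R unfolding \<rho>(1) by simp
  then have "\<rho> < 1" by (rule power2_less_imp_less) simp
  then have sub: "cball 0 \<rho> \<subseteq> unit_disc" by auto
  have "disc_orbit G ` unit_disc = disc_orbit G ` cball 0 \<rho>"
  proof
    show "disc_orbit G ` unit_disc \<subseteq> disc_orbit G ` cball 0 \<rho>"
    proof (rule image_subsetI)
      fix u assume "u \<in> unit_disc"
      then have u: "cmod u < 1" by simp
      obtain g where g: "g \<in> G" "disc_sep u (disc_act g 0) \<le> 2 * orbit_sep u" using orbit_sep_near[OF u] .
      obtain h where h: "h \<in> G" "g ** h = mat 1" "h ** g = mat 1" using obtain_inverse[OF g(1)] .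
      have hu: "cmod (disc_act h u) < 1" using h u det_eq_1 norm_disc_act_less_1 by blast
      have "disc_sep (disc_act h u) 0 = disc_sep u (disc_act g 0)"
        using disc_sep_disc_act[of h u "disc_act g 0"] act_inverse[of h g 0] act_0_less_1[OF g(1)] h g u det_eq_1
        by simp
      also have "\<dots> \<le> 2 * R" using g(2) assms[OF u] by linarith
      finally have "1 / (1 - (cmod (disc_act h u))\<^sup>2) \<le> 2 * R"
        unfolding disc_sep_commute[of "disc_act h u" 0] disc_sep_0_left .
      then have "(cmod (disc_act h u))\<^sup>2 \<le> \<rho>\<^sup>2"
      proof -
        assume "1 / (1 - (cmod (disc_act h u))\<^sup>2) \<le> 2 * R"
        then have "1 \<le> 2 * R * (1 - (cmod (disc_act h u))\<^sup>2)"
          using one_minus_norm_sq_bounds(1)[OF hu] by (simp only: pos_divide_le_eq)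
        then have "1 / (2 * R) \<le> 1 - (cmod (disc_act h u))\<^sup>2"
          using R by (simp add: pos_divide_le_eq mult.commute)
        then show ?thesis unfolding \<rho>(1) by simp
      qed
      then have "disc_act h u \<in> cball 0 \<rho>" using power2_le_imp_le[OF _ \<rho>(2)] by simp
      then show "disc_orbit G u \<in> disc_orbit G ` cball 0 \<rho>"
        unfolding disc_orbit_act[OF h(1) u, symmetric] by (rule imageI)
    qed
  qed (rule image_mono[OF sub])
  moreover have "compactin (orbit_space G) (disc_orbit G ` cball 0 \<rho>)"
  proof (rule image_compactin)
    show "compactin (top_of_set unit_disc) (cball 0 \<rho>)"
      using sub by (simp add: compactin_subtopology)
    show "continuous_map (top_of_set unit_disc) (orbit_space G) (disc_orbit G)"
      by (rule quotient_imp_continuous_map[OF quotient_map_orbit_space])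
  qed
  ultimately show ?thesis
    by (simp only: cocompact_def compact_space_def topspace_orbit_space)
qed

text \<open>A discrete intermediate value argument along the radius from the centre to a point with
  large \<open>orbit_sep\<close>. A step at most halves the distance to the circle and so raises
  \<open>orbit_sep\<close> by a factor of at most \<open>4 * 5\<close>; the first point that reaches
  \<open>R\<close> cannot overshoot.\<close>

lemma exists_orbit_sep:
  assumes "\<not> cocompact G" "1 \<le> R"
  obtains u where "cmod u < 1" "R \<le> orbit_sep u" "orbit_sep u \<le> 20 * R"
proof -
  obtain u where u: "cmod u < 1" "R < orbit_sep u"
    using cocompact_if_orbit_sep_bounded[of R] assms(1) by (meson not_le)
  have "orbit_sep 0 \<le> disc_sep 0 (disc_act (mat 1) 0)" by (rule orbit_sep_le) (auto simp: one_mem)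
  then have sep0: "orbit_sep 0 \<le> 1" by (simp add: disc_act_one disc_sep_0_left)
  define y where "y = 1 - cmod u"
  have u0: "u \<noteq> 0" using u sep0 assms(2) by auto
  define e where "e = sgn u"
  have e: "cmod e = 1" using u0 by (simp add: e_def norm_sgn)
  have ee: "cnj e * e = 1" using e by (metis complex_norm_square mult.commute of_real_1 one_power2)
  have y: "0 < y" "y < 1" using u u0 by (auto simp: y_def)
  \<comment> \<open>Distances to the circle, halved until they stop at \<open>y\<close>, so that the
    walk ends exactly at \<open>u\<close>.\<close>
  define x where "x j = max ((1 / 2) ^ j) y" for j :: nat
  have x: "0 < x j" "x j \<le> 1" "x (Suc j) \<le> x j" "x j \<le> 2 * x (Suc j)" for j
    using y by (auto simp: x_def max_def power_le_one)
  define v where "v j = of_real (1 - x j) * e" for j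
  have norm_v: "cmod (v j) = 1 - x j" for j
    using x[of j] e unfolding v_def norm_mult norm_of_real by simp
  have v1: "cmod (v j) < 1" for j using x by (simp add: norm_v)
  obtain n where "(1 / 2) ^ n < y" using real_arch_pow_inv[OF y(1), of "1 / 2"] by auto
  then have "x n = y" by (simp add: x_def)
  then have "v n = u" using u0 by (simp add: v_def e_def y_def sgn_div_norm scaleR_conv_of_real)
  then have ex: "\<exists>j. R \<le> orbit_sep (v j)" using u(2) by (intro exI[of _ n]) simp
  define j where "j = (LEAST j. R \<le> orbit_sep (v j))"
  have j: "R \<le> orbit_sep (v j)" unfolding j_def by (rule LeastI_ex[OF ex])
  have "orbit_sep (v j) \<le> 20 * R"
  proof (cases j)
    case 0
    then have "v j = 0" using y by (simp add: v_def x_def)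
    then show ?thesis using sep0 assms(2) by simp
  next
    case (Suc i)
    have less: "orbit_sep (v i) \<le> R"
      using not_less_Least[of i "\<lambda>j. R \<le> orbit_sep (v j)"] Suc unfolding j_def by linarith
    have "disc_sep (v j) (v i) \<le> 5"
    proof -
      define a b where "a = x j" and "b = x i"
      have ab: "0 < a" "a \<le> b" "b \<le> 2 * a" "b \<le> 1" using x[of i] x[of j] by (auto simp: a_def b_def Suc)
      have "1 - cnj (v j) * v i = of_real (a + b - a * b)"
      proof -
        have "cnj (v j) * v i = of_real ((1 - a) * (1 - b)) * (cnj e * e)"
          by (simp add: v_def a_def b_def mult_ac)
        then show ?thesis unfolding ee by (simp add: algebra_simps)
      qed
      then have n1: "(cmod (1 - cnj (v j) * v i))\<^sup>2 = (a + b - a * b)\<^sup>2"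
        by (simp only: norm_of_real power2_abs)
      have "a * b \<le> a * 1" "0 \<le> a * b" using ab by (intro mult_left_mono mult_nonneg_nonneg; linarith)+
      then have "0 \<le> a + b - a * b" "a + b - a * b \<le> a + b" using ab by linarith+
      then have n2: "(a + b - a * b)\<^sup>2 \<le> (a + b)\<^sup>2" by (rule power_mono[rotated])
      \<comment> \<open>The two expressions add up to
        \<open>(a + b)\<^sup>2 - 5 * (a * b)\<close>.\<close>
      have "a * (a - b) \<le> 0" "(b - 2 * a) * b \<le> 0"
        using ab by (simp_all add: mult_nonneg_nonpos mult_nonpos_nonneg)
      then have n3: "(a + b)\<^sup>2 \<le> 5 * (a * b)"
        by (simp add: power2_eq_square algebra_simps)
      have "a * b \<le> (1 - (cmod (v j))\<^sup>2) * (1 - (cmod (v i))\<^sup>2)"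
        using one_minus_norm_sq_bounds(2)[OF v1[of j]] one_minus_norm_sq_bounds(2)[OF v1[of i]] ab
        by (intro mult_mono) (auto simp: norm_v a_def b_def)
      then have "(cmod (1 - cnj (v j) * v i))\<^sup>2 \<le> 5 * ((1 - (cmod (v j))\<^sup>2) * (1 - (cmod (v i))\<^sup>2))"
        using n1 n2 n3 by linarith
      then show ?thesis
        using one_minus_norm_sq_bounds(1)[OF v1[of j]] one_minus_norm_sq_bounds(1)[OF v1[of i]]
        by (simp add: disc_sep_def divide_le_eq)
    qed
    then have "4 * disc_sep (v j) (v i) * orbit_sep (v i) \<le> 4 * 5 * R"
      using less orbit_sep_ge_1[OF v1[of i]] disc_sep_ge_1[OF v1 v1, of j i] by (intro mult_mono) auto
    then show ?thesis using orbit_sep_le_mult[OF v1 v1, of j i] by linarith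
  qed
  then show ?thesis by (rule that[OF v1 j])
qed

end

text \<open>The point below the left end of a dyadic arc whose distance to the circle is comparable to the length
  of the arc.\<close>

definition cell_point :: "nat \<Rightarrow> int \<Rightarrow> complex" where
  "cell_point k i = of_real (1 - 1 / 2 ^ k / 2) * cis (2 * pi * (i / 2 ^ k))"

section \<open>Points below dyadic arcs\<close>

lemma norm_cell_point: "cmod (cell_point k i) = 1 - 1 / 2 ^ k / 2"
proof -
  have *: "0 \<le> 1 - e / 2" if "e \<le> 1" for e :: real using that by simp
  have "0 \<le> 1 - (1::real) / 2 ^ k / 2" by (rule *) simp
  then show ?thesis unfolding cell_point_def norm_mult norm_of_real norm_cis by (simp only: abs_of_nonneg mult_1_right)
qed

lemma norm_cell_point_less_1: "cmod (cell_point k i) < 1"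
  by (simp add: norm_cell_point)

lemma cell_point_bounds:
  "1 / 2 ^ k / 2 \<le> 1 - (cmod (cell_point k i))\<^sup>2" "1 - (cmod (cell_point k i))\<^sup>2 \<le> 1 / 2 ^ k"
  using one_minus_norm_sq_bounds(2,3)[OF norm_cell_point_less_1[of k i]] by (simp_all add: norm_cell_point)

text \<open>The angles differ by at most \<open>1 / 2 ^ k\<close> turns, so the chord is at most
  \<open>2 * pi / 2 ^ k\<close>, rounded up to \<open>8 / 2 ^ k\<close>; the radial gap adds half of
  \<open>1 / 2 ^ k\<close>.\<close>

lemma cell_point_near:
  "cmod (cell_point k \<lfloor>2 ^ k * t\<rfloor> - cis (2 * pi * t)) \<le> 9 / 2 ^ k"
proof -
  define u where "u = \<lfloor>2 ^ k * t\<rfloor> / 2 ^ k"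
  have u: "\<bar>u - t\<bar> \<le> 1 / 2 ^ k"
  proof -
    have "\<bar>\<lfloor>2 ^ k * t\<rfloor> - 2 ^ k * t\<bar> \<le> 1" by linarith
    then have "\<bar>\<lfloor>2 ^ k * t\<rfloor> - 2 ^ k * t\<bar> / 2 ^ k \<le> 1 / 2 ^ k" by (rule divide_right_mono) simp
    moreover have "\<bar>u - t\<bar> = \<bar>\<lfloor>2 ^ k * t\<rfloor> - 2 ^ k * t\<bar> / 2 ^ k"
    proof -
      have "u - t = (\<lfloor>2 ^ k * t\<rfloor> - 2 ^ k * t) / 2 ^ k" by (simp add: u_def diff_divide_distrib)
      then show ?thesis by (simp only: abs_divide) simp
    qed
    ultimately show ?thesis by simp
  qed
  have "cell_point k \<lfloor>2 ^ k * t\<rfloor> - cis (2 * pi * t) =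
      (cis (2 * pi * u) - cis (2 * pi * t)) - of_real (1 / 2 ^ k / 2) * cis (2 * pi * u)"
    by (simp add: cell_point_def u_def algebra_simps)
  then have "cmod (cell_point k \<lfloor>2 ^ k * t\<rfloor> - cis (2 * pi * t)) \<le>
      cmod (cis (2 * pi * u) - cis (2 * pi * t)) + cmod (of_real (1 / 2 ^ k / 2) * cis (2 * pi * u))"
    by (metis norm_triangle_ineq4)
  also have "cmod (of_real (1 / 2 ^ k / 2) * cis (2 * pi * u)) = 1 / 2 ^ k / 2"
    unfolding norm_mult norm_of_real norm_cis by simp
  also have "cmod (cis (2 * pi * u) - cis (2 * pi * t)) \<le> 8 * (1 / 2 ^ k)"
  proof -
    have "cmod (cis (2 * pi * u) - cis (2 * pi * t)) \<le> \<bar>2 * pi * u - 2 * pi * t\<bar>" by (rule norm_cis_diff_le)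
    also have "\<dots> = 2 * pi * \<bar>u - t\<bar>" by (simp add: abs_mult flip: right_diff_distrib)
    also have "\<dots> \<le> 8 * (1 / 2 ^ k)" using u pi_less_4 by (intro mult_mono) auto
    finally show ?thesis .
  qed
  also have "8 * (1 / 2 ^ k) + 1 / 2 ^ k / 2 \<le> 9 * (1 / 2 ^ k :: real)"
  proof -
    have *: "8 * e + e / 2 \<le> 9 * e" if "0 \<le> e" for e :: real using that by simp
    show ?thesis by (rule *) simp
  qed
  finally show ?thesis by simp
qed

text \<open>For \<open>p\<close> on the circle, \<open>cmod (1 - cnj p * w)\<close> equals
  \<open>cmod (p - w)\<close>. Near the boundary the numerator of \<open>disc_sep\<close> can
  therefore be read as a Euclidean distance.\<close>

lemma norm_one_minus_cnj_near:
  assumes "cmod p = 1" "cmod w \<le> 1"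
  shows "\<bar>cmod (1 - cnj z * w) - cmod (p - w)\<bar> \<le> cmod (z - p)"
proof -
  have "p * cnj p = 1" using assms(1) by (metis complex_norm_square of_real_1 one_power2)
  then have "p - w = p * (1 - cnj p * w)" by (simp add: algebra_simps)
  then have "cmod (p - w) = cmod (1 - cnj p * w)" using assms(1) by (metis mult_1 norm_mult)
  then have "\<bar>cmod (1 - cnj z * w) - cmod (p - w)\<bar> \<le> cmod ((1 - cnj z * w) - (1 - cnj p * w))"
    by (simp only: norm_triangle_ineq3)
  also have "(1 - cnj z * w) - (1 - cnj p * w) = - (cnj (z - p) * w)" by (simp add: algebra_simps)
  also have "cmod (- (cnj (z - p) * w)) = cmod (z - p) * cmod w"
    unfolding norm_minus_cancel norm_mult complex_mod_cnj ..
  also have "\<dots> \<le> cmod (z - p)" using assms(2) by (simp add: mult_left_le)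
  finally show ?thesis .
qed

text \<open>If \<open>w\<close> is not in the shadow of the ancestor, then the geodesic from the cell point to \<open>w\<close> passes near
  the ancestor.\<close>

lemma disc_sep_ancestor_le:
  assumes "D \<le> k" "cmod w < 1" and far: "2 ^ D / 2 ^ k < cmod (cis (2 * pi * (i / 2 ^ k)) - w)"
  shows "disc_sep (cell_point (k - D) (i div 2 ^ D)) w \<le> 800 / 2 ^ D * disc_sep (cell_point k i) w"
proof -
  define \<delta> :: real where "\<delta> = 1 / 2 ^ k"
  define z where "z = cell_point k i"
  define v where "v = cell_point (k - D) (i div 2 ^ D)"
  define p where "p = cis (2 * pi * (i / 2 ^ k))"
  define P where "P = cmod (p - w)"
  define W where "W = 1 - (cmod w)\<^sup>2"
  have W: "0 < W" using one_minus_norm_sq_bounds(1)[OF assms(2)] by (simp add: W_def)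
  have \<delta>: "0 < \<delta>" by (simp add: \<delta>_def)
  have \<Delta>: "1 / 2 ^ (k - D) = 2 ^ D * \<delta>" using assms(1) by (simp add: \<delta>_def power_diff)
  have P: "2 ^ D * \<delta> < P" "\<delta> < P"
  proof -
    show "2 ^ D * \<delta> < P" using far by (simp add: P_def p_def \<delta>_def)
    moreover have "1 * \<delta> \<le> 2 ^ D * \<delta>" using \<delta> by (intro mult_right_mono) auto
    ultimately show "\<delta> < P" by simp
  qed
  have zp: "cmod (z - p) = \<delta> / 2"
  proof -
    have "z - p = - (of_real (\<delta> / 2) * p)" by (simp add: z_def cell_point_def p_def \<delta>_def algebra_simps)
    then show ?thesis using \<delta> by (simp add: norm_mult p_def)
  qed
  have "i div 2 ^ D = \<lfloor>2 ^ (k - D) * (i / 2 ^ k)\<rfloor>"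
  proof -
    have "2 ^ (k - D) * (real_of_int i / 2 ^ k) = real_of_int i / real_of_int (2 ^ D)"
      using assms(1) by (simp add: power_diff)
    then show ?thesis by (simp only: floor_divide_of_int_eq)
  qed
  then have vp: "cmod (v - p) \<le> 9 * (2 ^ D * \<delta>)"
    using cell_point_near[of "k - D" "i / 2 ^ k"] \<Delta> by (simp add: v_def p_def)
  define M where "M = cmod (1 - cnj z * w)"
  have "cmod p = 1" by (simp add: p_def)
  \<comment> \<open>\<open>M\<close> is at least \<open>P - \<delta> / 2\<close>, and the numerator
    for \<open>v\<close> is at most \<open>P + 9 * (2 ^ D * \<delta>)\<close>; both errors are
    controlled by \<open>P\<close>. The 800 below is \<open>2 * 20 * 20\<close>.\<close>
  from norm_one_minus_cnj_near[OF this, of w z] norm_one_minus_cnj_near[OF this, of w v] assms(2) zp vp P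
  have "P / 2 \<le> M" "cmod (1 - cnj v * w) \<le> 10 * P" unfolding P_def M_def by linarith+
  then have "cmod (1 - cnj v * w) \<le> 20 * M" by simp
  then have "(cmod (1 - cnj v * w))\<^sup>2 \<le> (20 * M)\<^sup>2" by (intro power_mono) auto
  then have "disc_sep v w \<le> (20 * M)\<^sup>2 / ((2 ^ D * \<delta> / 2) * W)"
    unfolding disc_sep_def W_def[symmetric]
    using cell_point_bounds(1)[of "k - D" "i div 2 ^ D"] \<delta> W \<Delta>
    by (intro frac_le mult_right_mono) (auto simp: v_def intro!: mult_pos_pos)
  also have "\<dots> = 800 / 2 ^ D * (M\<^sup>2 / (\<delta> * W))" by (simp add: power_mult_distrib field_simps)
  also have "\<dots> \<le> 800 / 2 ^ D * disc_sep z w"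
  proof -
    have z1: "0 < 1 - (cmod z)\<^sup>2" unfolding z_def by (rule one_minus_norm_sq_bounds(1)[OF norm_cell_point_less_1])
    have "M\<^sup>2 / (\<delta> * W) \<le> M\<^sup>2 / ((1 - (cmod z)\<^sup>2) * W)"
      using cell_point_bounds(2)[of k i] z1 W
      by (intro divide_left_mono mult_right_mono mult_pos_pos) (auto simp: z_def \<delta>_def)
    then show ?thesis unfolding disc_sep_def M_def W_def by (intro mult_left_mono) auto
  qed
  finally show ?thesis unfolding v_def z_def .
qed

text \<open>The numerator \<open>M\<close> dominates both the Euclidean distance and half of
  \<open>Y\<close>. The latter forces \<open>Y \<le> 4 * Q * X\<close>, and then
  \<open>M\<^sup>2 \<le> Q * (X * Y)\<close> gives the bound.\<close>

lemma disc_sep_step: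
  assumes "cmod x < 1" "cmod y < 1" "disc_sep x y \<le> Q"
  shows "cmod (x - y) \<le> 2 * Q * (1 - (cmod x)\<^sup>2)"
proof -
  define X where "X = 1 - (cmod x)\<^sup>2"
  define Y where "Y = 1 - (cmod y)\<^sup>2"
  define M where "M = cmod (1 - cnj x * y)"
  have pos: "0 < X" "0 < Y" using one_minus_norm_sq_bounds(1) assms by (auto simp: X_def Y_def)
  have Q: "1 \<le> Q" using disc_sep_ge_1[OF assms(1,2)] assms(3) by simp
  have M2: "M\<^sup>2 \<le> Q * (X * Y)"
    using assms(3) pos unfolding disc_sep_def M_def X_def Y_def by (simp add: divide_le_eq)
  have "1 - cmod y \<le> M"
  proof -
    have "cmod (cnj x * y) \<le> cmod y" using assms mult_right_mono[of "cmod x" 1 "cmod y"] by (simp add: norm_mult)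
    moreover have "cmod 1 - cmod (cnj x * y) \<le> M" unfolding M_def by (rule norm_triangle_ineq2)
    ultimately show ?thesis by simp
  qed
  then have "Y / 2 \<le> M" using one_minus_norm_sq_bounds(3)[OF assms(2)] by (simp add: Y_def)
  then have "(Y / 2)\<^sup>2 \<le> M\<^sup>2" using pos by (intro power_mono) auto
  moreover have "(Y / 2)\<^sup>2 = Y * Y / 4" "(4 * Q * X) * Y = 4 * (Q * (X * Y))" by (simp_all add: power2_eq_square)
  ultimately have "Y * Y \<le> (4 * Q * X) * Y" using M2 by linarith
  then have "Y \<le> 4 * Q * X" using pos by (simp only: mult_le_cancel_right_pos)
  then have "Q * (X * Y) \<le> Q * (X * (4 * Q * X))" using Q pos by (intro mult_left_mono) auto
  moreover have "(cmod (x - y))\<^sup>2 \<le> M\<^sup>2"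
    using pos unfolding M_def norm_one_minus_cnj_mult_sq X_def Y_def by simp
  ultimately have "(cmod (x - y))\<^sup>2 \<le> (2 * Q * X)\<^sup>2" using M2 by (simp add: power2_eq_square mult_ac)
  moreover have "0 \<le> 2 * Q * X" using Q pos by simp
  ultimately show ?thesis unfolding X_def by (rule power2_le_imp_le)
qed

section \<open>Distance to the orbit as a function on the dyadic tree\<close>

context SL2R_subgroup
begin

definition cell_sep :: "nat \<Rightarrow> int \<Rightarrow> real" where
  "cell_sep k i = orbit_sep (cell_point k i)"

lemma cell_sep_ge_1: "1 \<le> cell_sep k i"
  unfolding cell_sep_def by (rule orbit_sep_ge_1[OF norm_cell_point_less_1])

text \<open>Some \<open>u\<close> has \<open>orbit_sep\<close> about \<open>2 ^ r\<close>, and the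
  group moves it to \<open>w\<close> with \<open>disc_sep z w\<close> at most a multiple of
  \<open>2 ^ r\<close>. Then \<open>w\<close> lies in the shadow of the ancestor \<open>v\<close>:
  otherwise the geodesic from \<open>z\<close> to \<open>w\<close> passes near \<open>v\<close>,
  which is close to the orbit, and \<open>orbit_sep w\<close> would be too small. Comparison with
  \<open>z\<close> shows that \<open>w\<close> is at distance about \<open>1 / 2 ^ (k + r)\<close>
  from the circle, so the cell point of that level at its angle has bounded separation from
  \<open>w\<close>.\<close>

lemma cell_sep_spreading:
  assumes "\<not> cocompact G"
  shows "spreading cell_sep"
  unfolding spreading_def
proof
  fix B0 :: real
  define B where "B = max 1 B0"
  have B: "1 \<le> B" "B0 \<le> B" by (auto simp: B_def)
  \<comment> \<open>\<open>1024000\<close> is \<open>4 * 800 * 320\<close>, from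
    \<open>disc_sep_triangle\<close>, \<open>disc_sep_ancestor_le\<close> and \<open>zw\<close>.
    Below, \<open>s1\<close> and \<open>s2\<close> bound the distance \<open>y\<close> of
    \<open>w\<close> to the circle in units of \<open>\<eta>\<close>, and \<open>Q\<close> bounds
    the separation of \<open>w\<close> from the new cell point.\<close>
  obtain D :: nat where D: "1024000 * B\<^sup>2 < 2 ^ D" using real_arch_pow[of 2 "1024000 * B\<^sup>2"] by auto
  define s1 where "s1 = 1 / (2560 * B)"
  define s2 where "s2 = 32 * 4 ^ D * B"
  define Q where "Q = 2 * (s2 + 9)\<^sup>2 / s1"
  have s12: "0 < s1" "0 < s2" using B by (auto simp: s1_def s2_def)
  then have s: "0 < s1" "0 < s2" "0 < Q" by (auto simp: Q_def)
  obtain K0 :: nat where K0: "80 * Q \<le> K0" using real_arch_simple by blast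
  \<comment> \<open>\<open>80 * Q\<close> is \<open>4 * Q * 20\<close> and serves the values;
    \<open>2 ^ D + 1\<close> bounds the displacement of the arc, with 1 for the rounding in
    \<open>l\<close>.\<close>
  define K where "K = K0 + 2 ^ D + 1"
  have K: "80 * Q \<le> real K" "2 ^ D + 1 \<le> real K" using K0 zero_le_power[of "2::real" D] by (simp_all add: K_def del: zero_le_power)
  have "\<exists>l. \<bar>l - i * 2 ^ r\<bar> \<le> int K * 2 ^ r \<and> 2 ^ r \<le> real K * cell_sep (k + r) l \<and> cell_sep (k + r) l \<le> real K * 2 ^ r"
    if Dk: "D \<le> k" and sepz: "cell_sep k i \<le> B" and sepv: "cell_sep (k - D) (i div 2 ^ D) \<le> B" for k i r
  proof -
    define R :: real where "R = 2 ^ r"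
    have R: "1 \<le> R" by (simp add: R_def)
    define z where "z = cell_point k i"
    define v where "v = cell_point (k - D) (i div 2 ^ D)"
    have z1: "cmod z < 1" "cmod v < 1" unfolding z_def v_def by (rule norm_cell_point_less_1)+
    obtain u where u: "cmod u < 1" "R \<le> orbit_sep u" "orbit_sep u \<le> 20 * R"
      using exists_orbit_sep[OF assms R] .
    obtain g1 where g1: "g1 \<in> G" "disc_sep u (disc_act g1 0) \<le> 2 * orbit_sep u" using orbit_sep_near[OF u(1)] .
    obtain h where h: "h \<in> G" "h ** g1 = mat 1" using obtain_inverse[OF g1(1)] .
    obtain g where g: "g \<in> G" "disc_sep z (disc_act g 0) \<le> 2 * orbit_sep z" using orbit_sep_near[OF z1(1)] .
    \<comment> \<open>\<open>h\<close> carries the orbit point near \<open>u\<close> to the centre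
      and \<open>g\<close> carries the centre near \<open>z\<close>, so \<open>w\<close> is as far
      from \<open>disc_act g 0\<close> as \<open>u\<close> is from
      \<open>disc_act g1 0\<close>.\<close>
    define w where "w = disc_act g (disc_act h u)"
    have hu: "cmod (disc_act h u) < 1" using u h by (intro norm_disc_act_less_1 det_eq_1)
    have w1: "cmod w < 1" unfolding w_def by (rule norm_disc_act_less_1[OF det_eq_1[OF g(1)] hu])
    have sepw: "orbit_sep w = orbit_sep u" unfolding w_def using orbit_sep_act[OF hu g(1)] orbit_sep_act[OF u(1) h(1)] by simp
    have "disc_sep (disc_act g 0) w = disc_sep 0 (disc_act h u)"
      unfolding w_def using hu g det_eq_1 by (intro disc_sep_disc_act) auto
    also have "\<dots> = disc_sep (disc_act h (disc_act g1 0)) (disc_act h u)"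
      using act_inverse[OF h(1) g1(1) h(2), of 0] by simp
    also have "\<dots> = disc_sep u (disc_act g1 0)"
      using disc_sep_disc_act[OF det_eq_1[OF h(1)] act_0_less_1[OF g1(1)] u(1)] disc_sep_commute by simp
    finally have qw: "disc_sep (disc_act g 0) w \<le> 40 * R" using g1(2) u(3) by linarith
    have zw: "disc_sep z w \<le> 320 * B * R"
    proof -
      have "disc_sep z w \<le> 4 * disc_sep z (disc_act g 0) * disc_sep (disc_act g 0) w"
        by (rule disc_sep_triangle[OF z1(1) act_0_less_1[OF g(1)] w1])
      also have "\<dots> \<le> 4 * (2 * B) * (40 * R)"
        using g(2) sepz qw disc_sep_ge_1[OF act_0_less_1[OF g(1)] w1] disc_sep_ge_1[OF z1(1) act_0_less_1[OF g(1)]] B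
        by (intro mult_mono) (auto simp: cell_sep_def z_def)
      finally show ?thesis by simp
    qed
    define \<delta> :: real where "\<delta> = 1 / 2 ^ k"
    have \<delta>: "0 < \<delta>" by (simp add: \<delta>_def)
    define \<eta> where "\<eta> = \<delta> / R"
    have \<eta>: "0 < \<eta>" "\<eta> = 1 / 2 ^ (k + r)" using \<delta> R by (auto simp: \<eta>_def \<delta>_def R_def power_add)
    define t where "t = i / 2 ^ k"
    define p where "p = cis (2 * pi * t)"
    define y where "y = 1 - cmod w"
    have y: "0 < y" using w1 by (simp add: y_def)
    have near: "cmod (p - w) \<le> 2 ^ D * \<delta>"
    proof (rule ccontr)
      assume "\<not> ?thesis"
      then have "2 ^ D / 2 ^ k < cmod (cis (2 * pi * (i / 2 ^ k)) - w)" by (simp add: p_def t_def \<delta>_def)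
      from disc_sep_ancestor_le[OF Dk w1 this]
      have "disc_sep v w \<le> 800 / 2 ^ D * disc_sep z w" by (simp add: v_def z_def)
      also have "\<dots> \<le> 800 / 2 ^ D * (320 * B * R)" using zw by (intro mult_left_mono) auto
      finally have vw: "disc_sep w v \<le> 800 / 2 ^ D * (320 * B * R)" by (simp add: disc_sep_commute)
      have "R \<le> 4 * disc_sep w v * orbit_sep v" using orbit_sep_le_mult[OF w1 z1(2)] u(2) sepw by linarith
      also have "\<dots> \<le> 4 * (800 / 2 ^ D * (320 * B * R)) * B"
        using vw sepv B R disc_sep_ge_1[OF w1 z1(2)] orbit_sep_ge_1[OF z1(2)]
        by (intro mult_mono) (auto simp: cell_sep_def v_def)
      also have "\<dots> = R * (1024000 * B\<^sup>2 / 2 ^ D)" by (simp add: power2_eq_square)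
      finally have "R * 1 \<le> R * (1024000 * B\<^sup>2 / 2 ^ D)" by (simp only: mult_1_right)
      then have "1 \<le> 1024000 * B\<^sup>2 / 2 ^ D" using R by (subst (asm) mult_le_cancel_left_pos) auto
      then show False using D by (simp add: pos_le_divide_eq)
    qed
    have pw: "cmod p = 1" by (simp add: p_def)
    have yle: "y \<le> cmod (p - w)" using norm_triangle_ineq2[of p w] pw by (simp add: y_def)
    have zp: "cmod (z - p) = \<delta> / 2"
    proof -
      have "z - p = - (of_real (\<delta> / 2) * p)" by (simp add: z_def cell_point_def p_def t_def \<delta>_def algebra_simps)
      then show ?thesis using \<delta> by (simp add: norm_mult p_def)
    qed
    define M where "M = cmod (1 - cnj z * w)"
    have zbd: "\<delta> / 2 \<le> 1 - (cmod z)\<^sup>2" "1 - (cmod z)\<^sup>2 \<le> \<delta>"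
      using cell_point_bounds[of k i] by (auto simp: z_def \<delta>_def)
    have wbd: "y \<le> 1 - (cmod w)\<^sup>2" "1 - (cmod w)\<^sup>2 \<le> 2 * y"
      using one_minus_norm_sq_bounds[OF w1] by (auto simp: y_def)
    \<comment> \<open>The numerator is at least \<open>\<delta> / 2\<close>, so a smaller
      \<open>y\<close> would put \<open>w\<close> too far from \<open>z\<close>.\<close>
    have y_ge: "s1 * \<eta> \<le> y"
    proof -
      have "1 - cmod z \<le> M"
      proof -
        have "cmod (cnj z * w) \<le> cmod z" using w1 by (simp add: norm_mult mult_left_le)
        moreover have "cmod 1 - cmod (cnj z * w) \<le> M" unfolding M_def by (rule norm_triangle_ineq2)
        ultimately show ?thesis by simp
      qed
      then have "\<delta> / 2 \<le> M" by (simp add: z_def norm_cell_point \<delta>_def)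
      then have "(\<delta> / 2)\<^sup>2 / (\<delta> * (2 * y)) \<le> M\<^sup>2 / ((1 - (cmod z)\<^sup>2) * (1 - (cmod w)\<^sup>2))"
        using \<delta> y zbd wbd by (intro frac_le power_mono mult_mono mult_pos_pos) auto
      also have "\<dots> = disc_sep z w" by (simp add: disc_sep_def M_def)
      also note zw
      also have "(\<delta> / 2)\<^sup>2 / (\<delta> * (2 * y)) = \<delta> / (8 * y)" using \<delta> by (simp add: power2_eq_square)
      finally have "\<delta> \<le> 320 * B * R * (8 * y)" using y by (simp add: pos_divide_le_eq)
      then show ?thesis using B R unfolding s1_def \<eta>_def by (simp add: divide_simps mult_ac)
    qed
    \<comment> \<open>Conversely \<open>w\<close> is far from \<open>z\<close>, since
      \<open>orbit_sep w\<close> is large and \<open>orbit_sep z\<close> is at most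
      \<open>B\<close>; with a numerator of order \<open>2 ^ D * \<delta>\<close> only a small
      \<open>y\<close> allows this.\<close>
    have y_le: "y \<le> s2 * \<eta>"
    proof -
      have "1 * \<delta> \<le> 2 ^ D * \<delta>" using \<delta> by (intro mult_right_mono) auto
      then have "M \<le> 2 * (2 ^ D * \<delta>)"
        using norm_one_minus_cnj_near[OF pw, of w z] w1 near zp \<delta> unfolding M_def by linarith
      then have "M\<^sup>2 / ((1 - (cmod z)\<^sup>2) * (1 - (cmod w)\<^sup>2)) \<le> (2 * (2 ^ D * \<delta>))\<^sup>2 / (\<delta> / 2 * y)"
        using \<delta> y zbd wbd by (intro frac_le power_mono mult_mono mult_pos_pos) (auto simp: M_def)
      then have q: "disc_sep w z \<le> (2 * (2 ^ D * \<delta>))\<^sup>2 / (\<delta> / 2 * y)"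
        by (simp only: disc_sep_commute[of w z] disc_sep_def[of z w] M_def)
      have "R \<le> 4 * disc_sep w z * orbit_sep z" using orbit_sep_le_mult[OF w1 z1(1)] u(2) sepw by linarith
      also have "\<dots> \<le> 4 * ((2 * (2 ^ D * \<delta>))\<^sup>2 / (\<delta> / 2 * y)) * B"
        using q sepz B disc_sep_ge_1[OF w1 z1(1)] orbit_sep_ge_1[OF z1(1)]
        by (intro mult_mono) (auto simp: cell_sep_def z_def)
      also have "\<dots> = 32 * (2 ^ D)\<^sup>2 * B * \<delta> / y" using \<delta> by (simp add: power2_eq_square)
      finally have "R * y \<le> 32 * (2 ^ D)\<^sup>2 * B * \<delta>" using y by (simp add: pos_le_divide_eq)
      moreover have "((2::real) ^ D)\<^sup>2 = 4 ^ D" 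
      proof -
        have "((2::real) ^ D)\<^sup>2 = (2\<^sup>2) ^ D" by (simp only: power_mult[symmetric] mult.commute)
        then show ?thesis by simp
      qed
      ultimately show ?thesis using R by (simp add: s2_def \<eta>_def pos_le_divide_eq mult.commute)
    qed
    obtain x where x: "w = of_real (cmod w) * cis (2 * pi * x)" "\<bar>x - t\<bar> \<le> (cmod (p - w) + \<bar>1 - cmod w\<bar>) / 4"
      using exists_angle_near[OF p_def] .
    have xt: "\<bar>x - t\<bar> \<le> 2 ^ D * \<delta>"
      using x(2) near yle y by (simp add: y_def)
    define l where "l = \<lfloor>2 ^ (k + r) * x\<rfloor>"
    have l_near: "\<bar>l - i * 2 ^ r\<bar> \<le> int K * 2 ^ r"
    proof -
      have "\<bar>real_of_int l - 2 ^ (k + r) * x\<bar> \<le> 1" unfolding l_def by linarith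
      moreover have "\<bar>2 ^ (k + r) * x - real_of_int i * 2 ^ r\<bar> \<le> 2 ^ D * R"
      proof -
        have "2 ^ (k + r) * x - real_of_int i * 2 ^ r = 2 ^ (k + r) * (x - t)"
          by (simp add: t_def power_add algebra_simps)
        then have "\<bar>2 ^ (k + r) * x - real_of_int i * 2 ^ r\<bar> = 2 ^ (k + r) * \<bar>x - t\<bar>"
          by (simp add: abs_mult)
        also have "\<dots> \<le> 2 ^ (k + r) * (2 ^ D * \<delta>)" using xt by (intro mult_left_mono) auto
        also have "\<dots> = 2 ^ D * R" by (simp add: \<delta>_def R_def power_add)
        finally show ?thesis .
      qed
      ultimately have "\<bar>real_of_int l - real_of_int i * 2 ^ r\<bar> \<le> 2 ^ D * R + R" using R by linarith
      also have "\<dots> \<le> real K * R" using mult_right_mono[OF K(2), of R] R by (simp add: algebra_simps)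
      finally have "real_of_int \<bar>l - i * 2 ^ r\<bar> \<le> real_of_int (int K * 2 ^ r)" by (simp add: R_def)
      then show ?thesis by (simp only: of_int_le_iff)
    qed
    define z' where "z' = cell_point (k + r) l"
    have z'1: "cmod z' < 1" unfolding z'_def by (rule norm_cell_point_less_1)
    have q': "disc_sep z' w \<le> Q"
    proof -
      define p' where "p' = cis (2 * pi * x)"
      have p': "cmod p' = 1" by (simp add: p'_def)
      have "p' - w = of_real y * p'" by (subst x(1)) (simp add: p'_def y_def algebra_simps)
      then have "cmod (p' - w) = y" using y p' by (simp add: norm_mult)
      moreover have "cmod (z' - p') \<le> 9 * \<eta>"
        using cell_point_near[of "k + r" x] by (simp add: z'_def p'_def l_def \<eta>(2))
      ultimately have "cmod (1 - cnj z' * w) \<le> y + 9 * \<eta>"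
        using norm_one_minus_cnj_near[OF p', of w z'] w1 by linarith
      also have "\<dots> \<le> (s2 + 9) * \<eta>" using y_le by (simp add: algebra_simps)
      finally have num: "cmod (1 - cnj z' * w) \<le> (s2 + 9) * \<eta>" .
      have "\<eta> / 2 \<le> 1 - (cmod z')\<^sup>2" using cell_point_bounds(1)[of "k + r" l] by (simp add: z'_def \<eta>(2))
      moreover have "s1 * \<eta> \<le> 1 - (cmod w)\<^sup>2" using y_ge wbd by linarith
      ultimately have "disc_sep z' w \<le> ((s2 + 9) * \<eta>)\<^sup>2 / (\<eta> / 2 * (s1 * \<eta>))"
        unfolding disc_sep_def using num \<eta>(1) s by (intro frac_le power_mono mult_mono mult_pos_pos) auto
      also have "\<dots> = Q" using \<eta>(1) s by (simp add: Q_def power2_eq_square)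
      finally show ?thesis .
    qed
    have "R \<le> real K * orbit_sep z'"
    proof -
      have "R \<le> 4 * disc_sep w z' * orbit_sep z'" using orbit_sep_le_mult[OF w1 z'1] u(2) sepw by linarith
      also have "\<dots> \<le> real K * orbit_sep z'"
        using q' K(1) s orbit_sep_ge_1[OF z'1] by (intro mult_right_mono) (auto simp: disc_sep_commute[of w])
      finally show ?thesis .
    qed
    moreover have "orbit_sep z' \<le> real K * R"
    proof -
      have "orbit_sep z' \<le> 4 * disc_sep z' w * orbit_sep w" by (rule orbit_sep_le_mult[OF z'1 w1])
      also have "\<dots> \<le> 4 * Q * (20 * R)"
        using q' u s sepw orbit_sep_ge_1[OF w1] disc_sep_ge_1[OF z'1 w1] by (intro mult_mono) auto
      also have "\<dots> \<le> real K * R" using mult_right_mono[OF K(1), of R] R by simp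
      finally show ?thesis .
    qed
    ultimately show ?thesis using l_near unfolding R_def z'_def cell_sep_def by blast
  qed
  then show "\<exists>D K. \<forall>k i. D \<le> k \<longrightarrow> cell_sep k i \<le> B0 \<longrightarrow> cell_sep (k - D) (i div 2 ^ D) \<le> B0 \<longrightarrow>
     (\<forall>r. \<exists>l. \<bar>l - i * 2 ^ r\<bar> \<le> int K * 2 ^ r \<and> 2 ^ r \<le> real K * cell_sep (k + r) l \<and> cell_sep (k + r) l \<le> real K * 2 ^ r)"
    using B(2) by (meson order_trans)
qed

text \<open>The distances \<open>d j = cmod (p - x j)\<close> shrink from 1 to at most \<open>1 / 2 ^ T\<close>. While they cross
  \<open>[1 / 2 ^ (k + 1), 1 / 2 ^ k]\<close>, each step has Euclidean length \<open>O(1 / (2 ^ k * cell_sep k i))\<close>, where \<open>(k, i)\<close> is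
  the arc containing \<open>p\<close>.\<close>

lemma crossing_cost:
  assumes K: "2 * (1 + 4 * Q) \<le> real K" and Q: "1 \<le> Q"
    and x: "\<And>j. j \<le> n \<Longrightarrow> \<exists>g\<in>G. x j = disc_act g 0"
    and step: "\<And>j. j < n \<Longrightarrow> disc_sep (x j) (x (Suc j)) \<le> Q"
    and start: "x 0 = 0" and stop: "cmod (cis (2 * pi * t) - x n) \<le> 1 / 2 ^ T"
  shows "branch_sum T cell_sep 0 t \<le> 8 * Q * (real K + 9)\<^sup>2 * (real K)\<^sup>2 * n"
proof -
  \<comment> \<open>A step changes \<open>d\<close> by at most \<open>4 * Q\<close> times either of
    its end values, so consecutive distances have ratio at most \<open>c\<close>.\<close>
  define c where "c = 1 + 4 * Q"
  have c: "1 \<le> c" "2 * c \<le> K" using K Q by (auto simp: c_def)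
  define p where "p = cis (2 * pi * t)"
  have p: "cmod p = 1" by (simp add: p_def)
  have x1: "cmod (x j) < 1" if "j \<le> n" for j using x[OF that] act_0_less_1 by auto
  define d where "d j = cmod (p - x j)" for j
  have W: "1 - (cmod (x j))\<^sup>2 \<le> 2 * d j" if "j \<le> n" for j
    using one_minus_norm_sq_bounds(3)[OF x1[OF that]] norm_triangle_ineq2[of p "x j"] p by (simp add: d_def)
  have d_pos: "0 < d j" if "j \<le> n" for j
    using W[OF that] one_minus_norm_sq_bounds(1)[OF x1[OF that]] by simp
  define e where "e j = cmod (x j - x (Suc j))" for j
  have e: "e j \<le> 2 * Q * (1 - (cmod (x j))\<^sup>2)" "e j \<le> 4 * Q * d j" "e j \<le> 4 * Q * d (Suc j)" if "j < n" for j
  proof -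
    have j: "j \<le> n" "Suc j \<le> n" using that by auto
    show e1: "e j \<le> 2 * Q * (1 - (cmod (x j))\<^sup>2)"
      unfolding e_def by (rule disc_sep_step[OF x1[OF j(1)] x1[OF j(2)] step[OF that]])
    have "2 * Q * (1 - (cmod (x j))\<^sup>2) \<le> 2 * Q * (2 * d j)" using W[OF j(1)] Q by (intro mult_left_mono) auto
    then show "e j \<le> 4 * Q * d j" using e1 by simp
    have "e j \<le> 2 * Q * (1 - (cmod (x (Suc j)))\<^sup>2)"
      using disc_sep_step[OF x1[OF j(2)] x1[OF j(1)], of Q] step[OF that]
      by (simp add: e_def disc_sep_commute norm_minus_commute)
    also have "\<dots> \<le> 2 * Q * (2 * d (Suc j))" using W[OF j(2)] Q by (intro mult_left_mono) auto
    finally show "e j \<le> 4 * Q * d (Suc j)" by simp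
  qed
  have d_diff: "\<bar>d j - d (Suc j)\<bar> \<le> e j" for j
    using norm_triangle_ineq3[of "p - x j" "p - x (Suc j)"] by (simp add: d_def e_def norm_minus_commute)
  have d_ratio: "d j \<le> c * d (Suc j)" "d (Suc j) \<le> c * d j" if "j < n" for j
    using d_diff[of j] e(2,3)[OF that] by (simp_all add: c_def algebra_simps)
  define F where "F k = cell_sep k \<lfloor>2 ^ k * t\<rfloor>" for k
  have F0: "0 \<le> F k" for k using cell_sep_ge_1[of k] unfolding F_def by (rule order_trans[rotated]) simp
  define I where "I k = {j \<in> {..<n}. d j \<le> c / 2 ^ k \<and> 1 / 2 ^ k / 2 \<le> c * d j}" for k
  have F_le: "F k \<le> 8 * Q * (real K + 9)\<^sup>2 * card (I k)" if "k < T" for k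
  proof -
    define \<delta> :: real where "\<delta> = 1 / 2 ^ k"
    have \<delta>: "0 < \<delta>" "\<delta> \<le> 1" by (simp_all add: \<delta>_def)
    \<comment> \<open>Retraction onto the window \<open>[\<delta> / 2, \<delta>]\<close>. It leads
      from \<open>\<delta>\<close> at \<open>d 0\<close> to \<open>\<delta> / 2\<close> at
      \<open>d n\<close>, so its total variation is at least \<open>\<delta> / 2\<close>, and only
      steps in \<open>I k\<close> contribute to it.\<close>
    define clamp where "clamp s = max (\<delta> / 2) (min \<delta> s)" for s
    have lip: "\<bar>clamp s - clamp s'\<bar> \<le> \<bar>s - s'\<bar>" for s s' by (simp add: clamp_def max_def min_def)
    have "d 0 = 1" using p by (simp add: d_def start)
    then have c0: "clamp (d 0) = \<delta>" using \<delta> by (simp add: clamp_def)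
    have "d n \<le> \<delta> / 2"
    proof -
      have "(2::real) ^ Suc k \<le> 2 ^ T" using that by (intro power_increasing) auto
      then have "1 / 2 ^ T \<le> (1::real) / 2 ^ Suc k" by (intro divide_left_mono) auto
      then show ?thesis using stop by (simp add: d_def p_def \<delta>_def mult.commute)
    qed
    then have cn: "clamp (d n) = \<delta> / 2" using \<delta> by (simp add: clamp_def)
    have "F k * \<bar>clamp (d j) - clamp (d (Suc j))\<bar> \<le> (if j \<in> I k then 4 * Q * (real K + 9)\<^sup>2 * \<delta> else 0)" if j: "j < n" for j
    proof (cases "j \<in> I k")
      case True
      then have dj: "d j \<le> c * \<delta>" by (simp add: I_def \<delta>_def)
      obtain g where g: "g \<in> G" "x j = disc_act g 0" using x[of j] j by auto
      define z where "z = cell_point k \<lfloor>2 ^ k * t\<rfloor>"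
      define X where "X = 1 - (cmod (x j))\<^sup>2"
      have X: "0 < X" unfolding X_def using one_minus_norm_sq_bounds(1)[OF x1] j by simp
      have "cmod (z - p) \<le> 9 * \<delta>" using cell_point_near[of k t] by (simp add: z_def p_def \<delta>_def)
      then have "cmod (1 - cnj z * x j) \<le> c * \<delta> + 9 * \<delta>"
        using norm_one_minus_cnj_near[OF p, of "x j" z] x1[of j] j dj unfolding d_def by simp
      also have "\<dots> \<le> (real K + 9) * \<delta>" using c \<delta> by (simp add: algebra_simps)
      finally have num: "cmod (1 - cnj z * x j) \<le> (real K + 9) * \<delta>" .
      have "F k \<le> disc_sep z (x j)"
        unfolding F_def cell_sep_def z_def g(2) by (rule orbit_sep_le[OF norm_cell_point_less_1 g(1)])
      also have "\<dots> \<le> ((real K + 9) * \<delta>)\<^sup>2 / (\<delta> / 2 * X)"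
        unfolding disc_sep_def X_def[symmetric] using num cell_point_bounds(1)[of k "\<lfloor>2 ^ k * t\<rfloor>"] \<delta> X
        by (intro frac_le power_mono mult_right_mono mult_pos_pos) (auto simp: z_def \<delta>_def)
      \<comment> \<open>\<open>X\<close> cancels: since \<open>x j\<close> is an orbit point,
        \<open>F k\<close> is at most a multiple of \<open>\<delta> / X\<close>, and the step has
        length at most \<open>2 * Q * X\<close>.\<close>
      finally have "F k * \<bar>clamp (d j) - clamp (d (Suc j))\<bar> \<le> ((real K + 9) * \<delta>)\<^sup>2 / (\<delta> / 2 * X) * (2 * Q * X)"
        using lip[of "d j" "d (Suc j)"] d_diff[of j] e(1)[OF j] F0[of k] \<delta> X
        by (intro mult_mono) (auto simp: X_def)
      also have "\<dots> = 4 * Q * (real K + 9)\<^sup>2 * \<delta>" using \<delta> X by (simp add: power2_eq_square)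
      finally show ?thesis using True by simp
    next
      case False
      \<comment> \<open>Because of the ratio bound \<open>c\<close>, both ends of the step lie on
        the same side of the window.\<close>
      then consider "c * \<delta> < d j" | "c * d j < \<delta> / 2" using j by (auto simp: I_def \<delta>_def not_le)
      then have "clamp (d j) = clamp (d (Suc j))"
      proof cases
        case 1
        then have "c * \<delta> < c * d (Suc j)" using d_ratio(1)[OF j] by linarith
        then have "\<delta> < d (Suc j)" using c by simp
        moreover have "1 * \<delta> \<le> c * \<delta>" using c \<delta> by (intro mult_right_mono) auto
        then have "\<delta> < d j" using 1 by linarith
        ultimately show ?thesis using \<delta> by (simp add: clamp_def)
      next
        case 2
        have "d j \<le> c * d j" using c d_pos[of j] j by simp
        then show ?thesis using 2 d_ratio(2)[OF j] \<delta> by (simp add: clamp_def)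
      qed
      then show ?thesis using False by simp
    qed
    then have "(\<Sum>j<n. F k * \<bar>clamp (d j) - clamp (d (Suc j))\<bar>) \<le>
        (\<Sum>j<n. if j \<in> I k then 4 * Q * (real K + 9)\<^sup>2 * \<delta> else 0)"
      by (intro sum_mono) auto
    also have "\<dots> = card (I k) * (4 * Q * (real K + 9)\<^sup>2 * \<delta>)"
      by (simp add: sum.If_cases I_def Int_def)
    finally have upper: "F k * (\<Sum>j<n. \<bar>clamp (d j) - clamp (d (Suc j))\<bar>) \<le> card (I k) * (4 * Q * (real K + 9)\<^sup>2 * \<delta>)"
      by (simp only: sum_distrib_left)
    have "\<delta> / 2 = clamp (d 0) - clamp (d n)" by (simp add: c0 cn)
    also have "\<dots> = (\<Sum>j<n. clamp (d j) - clamp (d (Suc j)))" by (rule sum_lessThan_telescope'[symmetric])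
    also have "\<dots> \<le> (\<Sum>j<n. \<bar>clamp (d j) - clamp (d (Suc j))\<bar>)" by (intro sum_mono) simp
    finally have "F k * (\<delta> / 2) \<le> card (I k) * (4 * Q * (real K + 9)\<^sup>2 * \<delta>)"
      using upper mult_left_mono[OF _ F0[of k]] by (meson order_trans)
    then have "F k * (\<delta> / 2) \<le> (8 * Q * (real K + 9)\<^sup>2 * card (I k)) * (\<delta> / 2)" by (simp add: mult_ac)
    then show ?thesis using \<delta> by (subst (asm) mult_le_cancel_right_pos) auto
  qed
  \<comment> \<open>A step lies in \<open>I k\<close> only if \<open>2 ^ k\<close> is within the
    factor \<open>K\<close> of \<open>1 / d j\<close>, hence for at most \<open>K\<^sup>2\<close>
    levels.\<close>
  have "(\<Sum>k<T. card (I k)) \<le> n * K\<^sup>2"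
  proof -
    have "(\<Sum>k<T. card (I k)) = (\<Sum>k<T. \<Sum>j<n. if j \<in> I k then 1 else 0)"
      by (intro sum.cong refl) (simp add: sum.If_cases I_def Int_def)
    also have "\<dots> = (\<Sum>j<n. \<Sum>k<T. if j \<in> I k then 1 else 0)" by (rule sum.swap)
    also have "\<dots> = (\<Sum>j<n. card {k \<in> {..<T}. j \<in> I k})"
      by (intro sum.cong refl) (simp add: sum.If_cases Int_def)
    also have "\<dots> \<le> (\<Sum>j<n. K\<^sup>2)"
    proof (rule sum_mono)
      fix j assume "j \<in> {..<n}"
      then have j: "j < n" "0 < d j" using d_pos by auto
      have "0 < K" using c by simp
      then obtain r0 where r0: "{r. 2 ^ r \<le> real K * (1 / d j) \<and> 1 / d j \<le> real K * 2 ^ r} \<subseteq> {r0..<r0 + K\<^sup>2}"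
        by (rule dyadic_window)
      have "{k \<in> {..<T}. j \<in> I k} \<subseteq> {r0..<r0 + K\<^sup>2}"
      proof (rule subset_trans[OF _ r0], clarify)
        fix k assume "j \<in> I k"
        then have "d j * 2 ^ k \<le> c" "1 \<le> 2 * c * (d j * 2 ^ k)" by (simp_all add: I_def field_simps)
        moreover have "2 * c * (d j * 2 ^ k) \<le> K * (d j * 2 ^ k)" using c j by (intro mult_right_mono) auto
        ultimately have "d j * 2 ^ k \<le> K" "1 \<le> K * (d j * 2 ^ k)" using c by linarith+
        then show "2 ^ k \<le> real K * (1 / d j) \<and> 1 / d j \<le> real K * 2 ^ k"
          using j by (simp add: field_simps)
      qed
      then have "card {k \<in> {..<T}. j \<in> I k} \<le> card {r0..<r0 + K\<^sup>2}" by (intro card_mono) auto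
      then show "card {k \<in> {..<T}. j \<in> I k} \<le> K\<^sup>2" by simp
    qed
    finally show ?thesis by simp
  qed
  then have "real (\<Sum>k<T. card (I k)) \<le> real (n * K\<^sup>2)" by (simp only: of_nat_le_iff)
  then have cards: "(\<Sum>k<T. real (card (I k))) \<le> n * (real K)\<^sup>2" by simp
  have "branch_sum T cell_sep 0 t = (\<Sum>k<T. F k)" by (simp add: branch_sum_def F_def)
  also have "\<dots> \<le> (\<Sum>k<T. 8 * Q * (real K + 9)\<^sup>2 * card (I k))" using F_le by (intro sum_mono) auto
  also have "\<dots> = 8 * Q * (real K + 9)\<^sup>2 * (\<Sum>k<T. real (card (I k)))" by (simp add: sum_distrib_left)
  also have "\<dots> \<le> 8 * Q * (real K + 9)\<^sup>2 * (n * (real K)\<^sup>2)" using cards Q by (intro mult_left_mono) auto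
  finally show ?thesis by (simp add: mult_ac)
qed

end

section \<open>Word length and expansion\<close>

context group
begin

lemma foldr_mult_closed: "set ws \<subseteq> carrier G \<Longrightarrow> foldr (\<otimes>) ws \<one> \<in> carrier G"
  by (induction ws) auto

lemma foldr_mult_append:
  assumes "set us \<subseteq> carrier G" "set ws \<subseteq> carrier G"
  shows "foldr (\<otimes>) (us @ ws) \<one> = foldr (\<otimes>) us \<one> \<otimes> foldr (\<otimes>) ws \<one>"
  using assms by (induction us) (auto simp: foldr_mult_closed m_assoc)

lemma generate_imp_word:
  assumes "S \<subseteq> carrier G" "g \<in> generate G S"
  shows "\<exists>ws. set ws \<subseteq> S \<union> m_inv G ` S \<and> g = foldr (\<otimes>) ws \<one>"
  using assms(2)
proof (induction rule: generate.induct)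
  case one
  show ?case by (rule exI[of _ "[]"]) simp
next
  case (incl h)
  then show ?case using assms(1) by (intro exI[of _ "[h]"]) auto
next
  case (inv h)
  then show ?case using assms(1) by (intro exI[of _ "[inv h]"]) auto
next
  case (eng h1 h2)
  then obtain us ws where *: "set us \<subseteq> S \<union> m_inv G ` S" "h1 = foldr (\<otimes>) us \<one>"
    "set ws \<subseteq> S \<union> m_inv G ` S" "h2 = foldr (\<otimes>) ws \<one>" by blast
  have "S \<union> m_inv G ` S \<subseteq> carrier G" using assms(1) by auto
  with * have "set us \<subseteq> carrier G" "set ws \<subseteq> carrier G" by blast+
  from foldr_mult_append[OF this] * show ?case
    by (intro exI[of _ "us @ ws"]) (simp del: foldr_append)
qed

lemma word_length_attained:
  assumes "S \<subseteq> carrier G" "g \<in> generate G S"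
  obtains ws where "length ws = word_length G S g" "set ws \<subseteq> S \<union> m_inv G ` S" "g = foldr (\<otimes>) ws \<one>"
proof -
  have "\<exists>n ws. length ws = n \<and> set ws \<subseteq> S \<union> m_inv G ` S \<and> g = foldr (\<otimes>) ws \<one>"
    using generate_imp_word[OF assms] by blast
  from LeastI_ex[OF this] show ?thesis using that unfolding word_length_def by blast
qed

lemma word_ball_eq:
  assumes "S \<subseteq> carrier G"
  shows "word_ball G S R = {g \<in> generate G S. real (word_length G S g) \<le> R}"
proof -
  have "word_metric G S \<one> g = word_length G S g" if "g \<in> generate G S" for g
    using that generate_in_carrier[OF assms] by (simp add: word_metric_def)
  then show ?thesis unfolding word_ball_def by auto
qed

text \<open>A ball is covered by the values of the finitely many words of bounded length. Finiteness
  gives the \<open>Max\<close> in \<open>lyapunov_exp\<close> its meaning.\<close>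

lemma finite_word_ball:
  assumes "S \<subseteq> carrier G" "finite S"
  shows "finite (word_ball G S R)"
proof (rule finite_subset)
  show "finite ((\<lambda>ws. foldr (\<otimes>) ws \<one>) ` {ws. set ws \<subseteq> S \<union> m_inv G ` S \<and> length ws \<le> nat \<lfloor>R\<rfloor>})"
    using assms by (intro finite_imageI finite_lists_length_le) auto
  show "word_ball G S R \<subseteq> (\<lambda>ws. foldr (\<otimes>) ws \<one>) ` {ws. set ws \<subseteq> S \<union> m_inv G ` S \<and> length ws \<le> nat \<lfloor>R\<rfloor>}"
  proof
    fix g assume "g \<in> word_ball G S R"
    then have g: "g \<in> generate G S" "real (word_length G S g) \<le> R" by (auto simp: word_ball_eq[OF assms(1)])
    obtain ws where "length ws = word_length G S g" "set ws \<subseteq> S \<union> m_inv G ` S" "g = foldr (\<otimes>) ws \<one>"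
      using word_length_attained[OF assms(1) g(1)] .
    moreover have "word_length G S g \<le> nat \<lfloor>R\<rfloor>" using g(2) by linarith
    ultimately show "g \<in> (\<lambda>ws. foldr (\<otimes>) ws \<one>) ` {ws. set ws \<subseteq> S \<union> m_inv G ` S \<and> length ws \<le> nat \<lfloor>R\<rfloor>}"
      by auto
  qed
qed

lemma one_in_word_ball:
  assumes "S \<subseteq> carrier G" "0 \<le> R"
  shows "\<one> \<in> word_ball G S R"
proof -
  have "word_length G S \<one> \<le> 0"
    unfolding word_length_def by (rule Least_le) auto
  then show ?thesis using assms(2) by (simp add: word_ball_eq[OF assms(1)] generate.one)
qed

end

section \<open>From word length to the Lyapunov exponent\<close>

context SL2R_subgroup
begin

text \<open>The suffixes of a shortest word for \<open>g\<close> give a path of orbit points from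
  the centre to its preimage under \<open>g\<close>, and by isometry each step is as long as that of
  a single letter. A large derivative puts the end of the path close to the boundary point, so
  \<open>crossing_cost\<close> applies.\<close>

lemma word_cost:
  assumes "finite S" and gen: "generate SL2R S = G"
  obtains C :: real where "0 \<le> C"
    "\<And>t T g. g \<in> G \<Longrightarrow> 2 ^ Suc T \<le> circle_deriv g (cis (2 * pi * t)) \<Longrightarrow>
       branch_sum T cell_sep 0 t \<le> C * word_length SL2R S g"
proof -
  have SG: "S \<subseteq> G" using gen by (auto intro: generate.incl)
  define A where "A = S \<union> m_inv SL2R ` S"
  have Gc: "G \<subseteq> carrier SL2R" by (rule subgroup.subset[OF subgroup_SL2R])
  have AG: "A \<subseteq> G" using SG subgroup.m_inv_closed[OF subgroup_SL2R] by (auto simp: A_def)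
  have finA: "finite A" using assms by (simp add: A_def)
  have simps: "mult SL2R = (**)" "one SL2R = mat 1" by (simp_all add: SL2R_def)
  have inv_mem: "m_inv SL2R h \<in> G" if "h \<in> G" for h by (rule subgroup.m_inv_closed[OF subgroup_SL2R that])
  define Q where "Q = 1 + (\<Sum>s\<in>A. disc_sep 0 (disc_act (m_inv SL2R s) 0))"
  have sep_pos: "0 \<le> disc_sep 0 (disc_act (m_inv SL2R s) 0)" if "s \<in> A" for s
    using disc_sep_ge_1[of 0 "disc_act (m_inv SL2R s) 0"] act_0_less_1[OF inv_mem] AG that by force
  have Q: "1 \<le> Q" unfolding Q_def using sep_pos by (simp add: sum_nonneg)
  have Q_ge: "disc_sep 0 (disc_act (m_inv SL2R s) 0) \<le> Q" if "s \<in> A" for s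
    using member_le_sum[OF that, of "\<lambda>s. disc_sep 0 (disc_act (m_inv SL2R s) 0)"] sep_pos finA
    unfolding Q_def by simp
  obtain K :: nat where K: "2 * (1 + 4 * Q) \<le> real K" using real_arch_simple by blast
  define C where "C = 8 * Q * (real K + 9)\<^sup>2 * (real K)\<^sup>2"
  have "branch_sum T cell_sep 0 t \<le> C * word_length SL2R S g"
    if g: "g \<in> G" and deriv: "2 ^ Suc T \<le> circle_deriv g (cis (2 * pi * t))" for t T g
  proof -
    have "S \<subseteq> carrier SL2R" "g \<in> generate SL2R S" using SG Gc gen g by auto
    then obtain ws where ws: "length ws = word_length SL2R S g" "set ws \<subseteq> A" "g = foldr (mult SL2R) ws (one SL2R)"
      unfolding A_def by (rule SL2R.word_length_attained)
    define n where "n = length ws"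
    \<comment> \<open>Suffixes rather than prefixes: a letter \<open>s\<close> put in front of
      \<open>h j\<close> multiplies the inverse on the right, so \<open>m_inv SL2R (h j)\<close>
      acts on both points of the step and can be removed.\<close>
    define h where "h j = foldr (mult SL2R) (drop (n - j) ws) (one SL2R)" for j
    have h_mem: "h j \<in> G" for j
    proof -
      have "foldr (mult SL2R) us (one SL2R) \<in> G" if "set us \<subseteq> A" for us
        using that AG by (induction us) (auto simp: simps one_mem intro: mult_mem)
      moreover have "set (drop (n - j) ws) \<subseteq> A" using ws(2) set_drop_subset by fastforce
      ultimately show ?thesis by (simp add: h_def)
    qed
    define x where "x j = disc_act (m_inv SL2R (h j)) 0" for j
    have hn: "h n = g" using ws by (simp add: h_def)
    have x1: "cmod (x j) < 1" for j unfolding x_def by (rule act_0_less_1[OF inv_mem[OF h_mem]])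
    define p where "p = cis (2 * pi * t)"
    have "branch_sum T cell_sep 0 t \<le> 8 * Q * (real K + 9)\<^sup>2 * (real K)\<^sup>2 * n"
    proof (rule crossing_cost[OF K Q])
      show "\<exists>g\<in>G. x j = disc_act g 0" for j using inv_mem[OF h_mem] by (auto simp: x_def)
      show "x 0 = 0" using SL2R.inv_one by (simp add: x_def h_def n_def simps(2) disc_act_one)
      show "disc_sep (x j) (x (Suc j)) \<le> Q" if j: "j < n" for j
      proof -
        define s where "s = ws ! (n - Suc j)"
        have s: "s \<in> A" using ws(2) j by (auto simp: s_def n_def)
        have "drop (n - Suc j) ws = s # drop (n - j) ws"
          using Cons_nth_drop_Suc[of "n - Suc j" ws] j by (simp add: s_def n_def Suc_diff_Suc)
        then have "h (Suc j) = s \<otimes>\<^bsub>SL2R\<^esub> h j" by (simp add: h_def)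
        then have "m_inv SL2R (h (Suc j)) = m_inv SL2R (h j) \<otimes>\<^bsub>SL2R\<^esub> m_inv SL2R s"
          using s AG Gc h_mem by (simp add: SL2R.inv_mult_group subset_iff)
        then have "x (Suc j) = disc_act (m_inv SL2R (h j)) (disc_act (m_inv SL2R s) 0)"
          unfolding x_def simps using s AG h_mem inv_mem det_eq_1 by (simp add: disc_act_mult subset_iff)
        then have "disc_sep (x j) (x (Suc j)) = disc_sep 0 (disc_act (m_inv SL2R s) 0)"
          using s AG h_mem inv_mem det_eq_1 act_0_less_1
          by (simp add: x_def disc_sep_disc_act subset_iff)
        then show ?thesis using Q_ge[OF s] by simp
      qed
      show "cmod (cis (2 * pi * t) - x n) \<le> 1 / 2 ^ T"
      proof -
        have p: "cmod p = 1" by (simp add: p_def)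
        have "disc_act g (x n) = 0"
          unfolding x_def hn using act_inverse[OF g inv_mem[OF g], of 0] SL2R.r_inv[of g] g Gc by (auto simp: simps)
        then have eq: "circle_deriv g p = (1 - (cmod (x n))\<^sup>2) / (cmod (p - x n))\<^sup>2"
          by (rule disc_act_zero_imp[OF det_eq_1[OF g] x1 _ p])
        define d where "d = cmod (p - x n)"
        have le: "1 - (cmod (x n))\<^sup>2 \<le> 2 * d"
          using one_minus_norm_sq_bounds(3)[OF x1[of n]] norm_triangle_ineq2[of p "x n"] p by (simp add: d_def)
        then have d: "0 < d" using one_minus_norm_sq_bounds(1)[OF x1[of n]] by simp
        \<comment> \<open>The Poisson kernel is at most \<open>2 / d\<close>; this 2 is the reason
          for \<open>Suc T\<close>.\<close>
        have "2 * 2 ^ T \<le> (1 - (cmod (x n))\<^sup>2) / d\<^sup>2" using deriv eq by (simp add: p_def d_def)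
        also have "\<dots> \<le> 2 * d / d\<^sup>2" using le by (rule divide_right_mono) simp
        also have "\<dots> = 2 * (1 / d)" using d by (simp add: power2_eq_square)
        finally have "2 ^ T \<le> 1 / d" by simp
        then show ?thesis using d by (simp add: d_def p_def field_simps)
      qed
    qed
    then show ?thesis using ws(1) by (simp add: C_def n_def)
  qed
  moreover have "0 \<le> C" using Q by (simp add: C_def)
  ultimately show ?thesis by (rule that[rotated])
qed

text \<open>The identity gives the lower bound 0. An element of length at most \<open>R\<close> with
  derivative above \<open>exp (\<epsilon> * R)\<close> would, by \<open>word_cost\<close>, keep the
  sum over about \<open>\<epsilon> * R / ln 2\<close> levels at or below \<open>C * R\<close>,
  against superlinear growth.\<close>

lemma lyapunov_exp_eq_0:
  assumes fin: "finite S" and gen: "generate SL2R S = G"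
    and super: "\<forall>A. \<forall>\<^sub>F T in sequentially. A * real T \<le> branch_sum T cell_sep 0 t"
  shows "lyapunov_exp S (cis (2 * pi * t)) = 0"
proof -
  define p where "p = cis (2 * pi * t)"
  have p: "cmod p = 1" by (simp add: p_def)
  have Sc: "S \<subseteq> carrier SL2R"
    using subgroup.subset[OF subgroup_SL2R] gen by (auto intro: generate.incl)
  define X where "X R = (\<lambda>g. 1 / R * ln \<bar>circle_deriv g p\<bar>) ` word_ball SL2R S R" for R :: real
  have finX: "finite (X R)" for R unfolding X_def by (intro finite_imageI SL2R.finite_word_ball Sc fin)
  have zero_in: "0 \<in> X R" if "0 \<le> R" for R
  proof -
    have "circle_deriv (mat 1) p = 1" using circle_deriv_eq[of "mat 1" p] p
      by (simp add: disc_den_def su_alpha_one su_beta_one)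
    moreover have "mat 1 \<in> word_ball SL2R S R"
      using SL2R.one_in_word_ball[OF Sc that] by (simp add: SL2R_def)
    ultimately show ?thesis unfolding X_def by (intro image_eqI[of _ _ "mat 1"]) auto
  qed
  have lyap: "lyapunov_exp S p = Limsup at_top (\<lambda>R. ereal (Max (X R)))"
    by (simp add: lyapunov_exp_def X_def)
  have "0 \<le> lyapunov_exp S p"
    unfolding lyap
  proof (rule le_Limsup)
    show "\<forall>\<^sub>F R in at_top. 0 \<le> ereal (Max (X R))"
      using eventually_ge_at_top[of "0::real"]
      by eventually_elim (use Max_ge[OF finX zero_in] in auto)
  qed simp
  moreover have "lyapunov_exp S p \<le> ereal \<epsilon>" if \<epsilon>: "0 < \<epsilon>" for \<epsilon>
  proof -
    obtain C :: real where C: "0 \<le> C" "\<And>t T g. g \<in> G \<Longrightarrow> 2 ^ Suc T \<le> circle_deriv g (cis (2 * pi * t)) \<Longrightarrow>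
       branch_sum T cell_sep 0 t \<le> C * word_length SL2R S g"
      using word_cost[OF fin gen] by blast
    \<comment> \<open>Makes \<open>A * (y / 2)\<close> equal to \<open>(C + 1) * R\<close>, which
      exceeds \<open>C * R\<close>.\<close>
    define A where "A = (C + 1) * (2 * ln 2) / \<epsilon>"
    obtain T0 where T0: "\<And>T. T0 \<le> T \<Longrightarrow> A * real T \<le> branch_sum T cell_sep 0 t"
      using super unfolding eventually_sequentially by meson
    have "Max (X R) \<le> \<epsilon>" if R: "(real T0 + 4) * ln 2 / \<epsilon> \<le> R" for R
    proof -
      have "0 < (real T0 + 4) * ln 2 / \<epsilon>" using \<epsilon> by simp
      then have R0: "0 < R" using R by linarith
      define y where "y = \<epsilon> * R / ln 2"
      have y: "real T0 + 4 \<le> y" using R \<epsilon> by (simp add: y_def field_simps)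
      \<comment> \<open>\<open>y\<close> solves \<open>2 powr y = exp (\<epsilon> * R)\<close>; one
        level is given up for the \<open>Suc T\<close> in \<open>word_cost\<close>.\<close>
      define T where "T = nat \<lfloor>y\<rfloor> - 1"
      have T: "real T + 1 \<le> y" "y / 2 \<le> real T" "T0 \<le> T"
      proof -
        have "real (nat \<lfloor>y\<rfloor>) \<le> y" "y < real (nat \<lfloor>y\<rfloor>) + 1" using y by linarith+
        moreover have "1 \<le> nat \<lfloor>y\<rfloor>" using y by linarith
        then have "real T = real (nat \<lfloor>y\<rfloor>) - 1" by (simp add: T_def of_nat_diff)
        ultimately show "real T + 1 \<le> y" "y / 2 \<le> real T" "T0 \<le> T" using y by linarith+
      qed
      have "1 / R * ln \<bar>circle_deriv g p\<bar> \<le> \<epsilon>" if "g \<in> word_ball SL2R S R" for g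
      proof (rule ccontr)
        assume "\<not> ?thesis"
        then have big: "\<epsilon> * R < ln \<bar>circle_deriv g p\<bar>" using R0 by (simp add: field_simps not_le)
        have g: "g \<in> G" "real (word_length SL2R S g) \<le> R"
          using that gen by (auto simp: SL2R.word_ball_eq[OF Sc])
        have pos: "0 < circle_deriv g p"
          using disc_den_nonzero[OF det_eq_1[OF g(1)], of p] p by (simp add: circle_deriv_eq[OF det_eq_1[OF g(1)] p])
        have "(2::real) ^ Suc T = exp (real (Suc T) * ln 2)" by (simp add: exp_of_nat_mult del: power_Suc of_nat_Suc)
        also have "\<dots> \<le> exp (\<epsilon> * R)"
          using T(1) by (simp add: y_def field_simps)
        also have "\<dots> \<le> exp (ln (circle_deriv g p))"
          unfolding exp_le_cancel_iff using big pos by simp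
        also have "\<dots> = circle_deriv g p" using pos by simp
        finally have "branch_sum T cell_sep 0 t \<le> C * word_length SL2R S g"
          using C(2)[OF g(1), of T t] by (simp add: p_def)
        also have "\<dots> \<le> C * R" using g(2) C(1) by (intro mult_left_mono)
        finally have "A * T \<le> C * R" using T0[OF T(3)] by simp
        moreover have "(C + 1) * R = A * (y / 2)" using \<epsilon> by (simp add: A_def y_def)
        moreover have "A * (y / 2) \<le> A * T" using T(2) C(1) \<epsilon> by (intro mult_left_mono) (auto simp: A_def)
        ultimately have "(C + 1) * R \<le> C * R" by linarith
        then show False using R0 by (simp add: algebra_simps)
      qed
      then show ?thesis using finX zero_in[of R] R0 by (subst Max_le_iff) (auto simp: X_def)
    qed
    then have "\<forall>\<^sub>F R in at_top. ereal (Max (X R)) \<le> ereal \<epsilon>"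
      by (intro eventually_mono[OF eventually_ge_at_top[of "(real T0 + 4) * ln 2 / \<epsilon>"]]) simp
    then show ?thesis unfolding lyap by (rule Limsup_bounded)
  qed
  then have "lyapunov_exp S p \<le> 0 + ereal \<epsilon>" if "0 < \<epsilon>" for \<epsilon> :: real
    using that by (simp only: add_0)
  then have "lyapunov_exp S p \<le> 0" by (rule ereal_le_epsilon2)
  ultimately show ?thesis by (simp add: p_def)
qed

end

section \<open>Transfer to Lebesgue measure on the circle\<close>

text \<open>The exceptional set need not be visibly Borel, so the good set is replaced by a \<open>\<sigma>\<close>-compact subset.\<close>

lemma AE_circle_lebesgueI:
  assumes "AE t in lborel. t \<in> {0..<1} \<longrightarrow> P (cis (2 * pi * t))"
  shows "AE p in circle_lebesgue. P p"
proof -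
  obtain N where N: "N \<in> null_sets lborel" "{t \<in> space lborel. \<not> (t \<in> {0..<1} \<longrightarrow> P (cis (2 * pi * t)))} \<subseteq> N"
    using assms unfolding eventually_ae_filter by blast
  define N' where "N' = (\<lambda>t. 2 * pi * t) ` N"
  have "negligible N" using N(1) by (simp add: negligible_iff_null_sets null_sets_completionI)
  then have neg: "negligible N'" unfolding N'_def
    by (rule negligible_differentiable_image_negligible[OF order_refl _
          linear_imp_differentiable_on[OF bounded_linear.linear[OF bounded_linear_mult_right]]])
  define S0 where "S0 = {0..<2 * pi} - N'"
  have "S0 \<in> sets lebesgue" unfolding S0_def using negligible_imp_sets[OF neg] by (intro sets.Diff) simp_all
  then obtain C Z where CZ: "fsigma C" "Z \<in> null_sets lebesgue" "C \<union> Z = S0"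
    by (rule lebesgue_set_almost_fsigma)
  obtain F :: "nat \<Rightarrow> real set" where F: "\<And>n. closed (F n)" "C = (\<Union>n. F n)"
    using CZ(1) by cases blast
  \<comment> \<open>The sets \<open>F n\<close> are closed and bounded, so their images are compact
    and \<open>E\<close> is Borel, as \<open>AE_distr_iff\<close> requires.\<close>
  define E where "E = (\<Union>n. cis ` F n)"
  have "closed (cis ` F n)" for n
  proof -
    have "F n \<subseteq> S0" unfolding CZ(3)[symmetric] F(2) by blast
    moreover have "S0 \<subseteq> {0..2 * pi}" unfolding S0_def by auto
    ultimately have "F n \<subseteq> {0..2 * pi}" by (rule subset_trans)
    then have "bounded (F n)" by (rule bounded_subset[OF bounded_closed_interval])
    then have "compact (F n)" using F(1) by (simp add: compact_eq_bounded_closed)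
    then show ?thesis by (intro compact_imp_closed compact_continuous_image continuous_intros)
  qed
  then have E: "E \<in> sets borel" unfolding E_def by auto
  have E_sub: "E \<subseteq> sphere 0 1" by (auto simp: E_def)
  have PE: "P p" if p: "p \<in> E" for p
  proof -
    obtain n \<theta> where \<theta>: "\<theta> \<in> F n" "p = cis \<theta>" using p unfolding E_def by blast
    then have "\<theta> \<in> S0" unfolding CZ(3)[symmetric] F(2) by blast
    then have S0: "0 \<le> \<theta>" "\<theta> < 2 * pi" "\<theta> \<notin> N'" by (simp_all add: S0_def)
    have "\<theta> / (2 * pi) \<notin> N"
    proof
      assume "\<theta> / (2 * pi) \<in> N"
      then have "2 * pi * (\<theta> / (2 * pi)) \<in> N'" unfolding N'_def by (rule imageI)
      then show False using S0(3) by simp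
    qed
    moreover have "\<theta> / (2 * pi) \<in> {0..<1}" using S0(1,2) by simp
    ultimately have "P (cis (2 * pi * (\<theta> / (2 * pi))))" using N(2) unfolding space_lborel space_borel by blast
    then show ?thesis using \<theta>(2) by simp
  qed
  have "AE p in circle_lebesgue. p \<in> E"
    unfolding circle_lebesgue_def
  proof (subst AE_distr_iff[OF measurable_cis_circle])
    show "{p \<in> space (restrict_space borel (sphere 0 1)). p \<in> E} \<in> sets (restrict_space borel (sphere 0 1))"
    proof -
      have "{p \<in> space (restrict_space borel (sphere 0 1)). p \<in> E} = sphere 0 1 \<inter> E"
        unfolding space_restrict_space by auto
      then show ?thesis unfolding sets_restrict_space using E by (simp only: imageI)
    qed
    have "AE \<theta> in lebesgue. \<theta> \<in> {0..<2 * pi} \<longrightarrow> cis \<theta> \<in> E"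
    proof (rule AE_I')
      show "N' \<union> Z \<in> null_sets lebesgue" using neg CZ(2) by (simp only: negligible_iff_null_sets null_sets.Un)
      show "{\<theta> \<in> space lebesgue. \<not> (\<theta> \<in> {0..<2 * pi} \<longrightarrow> cis \<theta> \<in> E)} \<subseteq> N' \<union> Z"
      proof (rule subsetI, rule ccontr)
        fix \<theta> assume "\<theta> \<in> {\<theta> \<in> space lebesgue. \<not> (\<theta> \<in> {0..<2 * pi} \<longrightarrow> cis \<theta> \<in> E)}" "\<theta> \<notin> N' \<union> Z"
        then have \<theta>: "\<theta> \<in> S0" "cis \<theta> \<notin> E" "\<theta> \<notin> Z" by (simp_all add: S0_def)
        then have "\<theta> \<in> C" unfolding CZ(3)[symmetric] by simp
        then obtain n where "\<theta> \<in> F n" unfolding F(2) by (rule UN_E)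
        then have "cis \<theta> \<in> E" unfolding E_def by (intro UN_I[of n] imageI) simp_all
        with \<theta>(2) show False by contradiction
      qed
    qed
    then show "AE \<theta> in lebesgue_on {0..<2 * pi}. cis \<theta> \<in> E"
      by (simp add: AE_restrict_space_iff)
  qed
  then show ?thesis by (rule AE_mp) (auto intro: PE)
qed

theorem theorem1p3:
  fixes G S :: "(real^2^2) set"
  assumes "fuchsian_group G"
    and "cofinite_volume G"
    and "\<not> cocompact G"
    and "finite S"
    and "generate SL2R S = G"
  shows "AE p in circle_lebesgue. lyapunov_exp S p = 0"
proof -
  interpret SL2R_subgroup G
    using assms(1) by (intro SL2R_subgroup.intro) (simp add: fuchsian_group_def)
  have "0 \<le> cell_sep k i" for k i using cell_sep_ge_1[of k i] by simp
  from branch_sum_superlinear[OF this cell_sep_spreading[OF assms(3)]]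
  have "AE t in lborel. t \<in> {0..<1} \<longrightarrow> lyapunov_exp S (cis (2 * pi * t)) = 0"
    by eventually_elim (use lyapunov_exp_eq_0[OF assms(4,5)] in blast)
  then show ?thesis by (rule AE_circle_lebesgueI)
qed

end
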